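(* Let $f\colon X\to X$ be a non-expanding self-map of a proper geodesic Gromov hyperbolic metric space $(X,d)$. (i) If a boundary regular fixed point $\eta$ of $f$ has stable dilation $\Lambda_\eta<1$, then $f$ is hyperbolic and $\eta$ is its Denjoy--Wolff point. (ii) If $f$ is non-elliptic, then the only boundary regular fixed point $\eta$ with stable dilation $\Lambda_\eta\le1$ is the Denjoy--Wolff point. (iii) If $f$ is elliptic and $\eta$ is a boundary regular fixed point, then $\Lambda_\eta=1$ if and only if $\eta$ is contained in the closure $\overline{\omega_f}^G$, in the Gromov compactification, of the limit retract $\omega_f$.
   Context: Non-expanding: $d(f(x),f(y))\le d(x,y)$. Gromov hyperbolic: for some $\delta>0$, in every geodesic triangle each side lies in the $\delta$-neighborhood of the union of the other two. $\partial_GX$ is the Gromov boundary; $\overline X^G=X\sqcup\partial_GX$ the Gromov compactification. For non-expanding $g$, $\log\lambda_{\eta,p}(g)=\liminf_{z\to\eta}[d(z,p)-d(g(z),p)]$, $p\in X$, $\eta\in\partial_GX$. Geodesic region: $\{x\in X: d(x,\gamma)<R\}$ for a geodesic ray $\gamma$ and $R>0$, with vertex $[\gamma]$. $g$ has geodesic limit $\xi$ at $\eta$ if $g(x_n)\to\xi$ for every sequence $x_n\to\eta$ contained in a geodesic region with vertex $\eta$. $\eta\in\partial_GX$ is a boundary regular fixed point (BRFP) of $g$ if $\lambda_{\eta,p}(g)<+\infty$ (independent of $p$) and $g$ has geodesic limit $\eta$ at $\eta$. A BRFP of $f$ is a BRFP of all iterates, and its stable dilation is given by $\log\Lambda_\eta=\lim_{n\to\infty}\frac1n\log\lambda_{\eta,p}(f^n)$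 (the limit exists, is finite, independent of $p$). $f$ is elliptic if some (equivalently every) forward orbit is bounded; then the limit retract $\omega_f$ is the union over $x\in X$ of the sets of limit points in $X$ of $(f^n(x))_n$. If $f$ is non-elliptic, all forward orbits converge to one point $\zeta\in\partial_GX$, the Denjoy--Wolff point, which is a BRFP with $\log\Lambda_\zeta=-c(f)$, where $c(f)=\lim_nd(x,f^n(x))/n$. A non-elliptic $f$ is hyperbolic if $\Lambda_\zeta<1$ (equivalently $c(f)>0$) and parabolic if $\Lambda_\zeta=1$ (equivalently $c(f)=0$). *)

theory Defs
  imports "HOL-Analysis.Analysis"
begin

text \<open>The metric space $X$ is the whole of a type of class \<^class>\<open>metric_space\<close>.\<close>

definition proper_space :: "'a::metric_space itself \<Rightarrow> bool" where
  "proper_space _ \<longleftrightarrow> (\<forall>(x::'a) r. compact (cball x r))"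

definition geodesic_segment :: "'a::metric_space \<Rightarrow> 'a \<Rightarrow> 'a set \<Rightarrow> bool" where
  "geodesic_segment x y S \<longleftrightarrow>
     (\<exists>c. c 0 = x \<and> c (dist x y) = y \<and>
          (\<forall>s\<in>{0..dist x y}. \<forall>t\<in>{0..dist x y}. dist (c s) (c t) = \<bar>s - t\<bar>) \<and>
          S = c ` {0..dist x y})"

definition geodesic_space :: "'a::metric_space itself \<Rightarrow> bool" where
  "geodesic_space _ \<longleftrightarrow> (\<forall>x y::'a. \<exists>S. geodesic_segment x y S)"

text \<open>Only the side $A$ is mentioned in the conclusion; the other two sides are covered by
  permuting the vertices cyclically.\<close>

definition gromov_hyperbolic_space :: "'a::metric_space itself \<Rightarrow> bool" where
  "gromov_hyperbolic_space _ \<longleftrightarrow>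
     (\<exists>\<delta>>0. \<forall>(x::'a) y z A B C.
        geodesic_segment x y A \<longrightarrow> geodesic_segment y z B \<longrightarrow> geodesic_segment z x C \<longrightarrow>
        (\<forall>a\<in>A. infdist a (B \<union> C) < \<delta>))"

text \<open>A ray is a function on all of \<^typ>\<open>real\<close> of which only the values on $[0,\infty)$ matter:
  the equivalence class of a ray contains all its modifications at negative arguments.\<close>

definition geodesic_ray :: "(real \<Rightarrow> 'a::metric_space) \<Rightarrow> bool" where
  "geodesic_ray \<gamma> \<longleftrightarrow> (\<forall>s\<ge>0. \<forall>t\<ge>0. dist (\<gamma> s) (\<gamma> t) = \<bar>s - t\<bar>)"

definition asymptotic_rays :: "((real \<Rightarrow> 'a::metric_space) \<times> (real \<Rightarrow> 'a)) set" where
  "asymptotic_rays = {(\<gamma>, \<sigma>). geodesic_ray \<gamma> \<and> geodesic_ray \<sigma> \<and>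
                              (\<exists>C. \<forall>t\<ge>0. dist (\<gamma> t) (\<sigma> t) \<le> C)}"

definition gromov_boundary :: "(real \<Rightarrow> 'a::metric_space) set set" where
  "gromov_boundary = Collect geodesic_ray // asymptotic_rays"

definition vertex :: "(real \<Rightarrow> 'a::metric_space) \<Rightarrow> (real \<Rightarrow> 'a) set" where
  "vertex \<gamma> = asymptotic_rays `` {\<gamma>}"

definition gromov_product :: "'a::metric_space \<Rightarrow> 'a \<Rightarrow> 'a \<Rightarrow> real" where
  "gromov_product p x y = (dist x p + dist y p - dist x y) / 2"

text \<open>The usual neighbourhood basis (not consisting of open sets in general) at the boundary
  point $\xi$, as seen from the base point $p$: all $y$ in $X \sqcup \partial_G X$ such that for
  suitable rays from $p$ the Gromov product of $\xi$ and $y$ is at least $r$.\<close>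

definition gromov_nbhd ::
  "'a::metric_space \<Rightarrow> (real \<Rightarrow> 'a) set \<Rightarrow> real \<Rightarrow> ('a + (real \<Rightarrow> 'a) set) set" where
  "gromov_nbhd p \<xi> r =
     {Inl y |y. \<exists>\<gamma>\<in>\<xi>. \<gamma> 0 = p \<and>
        ereal r \<le> Liminf at_top (\<lambda>t. ereal (gromov_product p (\<gamma> t) y))} \<union>
     {Inr \<zeta> |\<zeta>. \<zeta> \<in> gromov_boundary \<and> (\<exists>\<gamma>\<in>\<xi>. \<exists>\<sigma>\<in>\<zeta>. \<gamma> 0 = p \<and> \<sigma> 0 = p \<and>
        ereal r \<le> Liminf at_top (\<lambda>t. ereal (gromov_product p (\<gamma> t) (\<sigma> t))))}"

text \<open>In a proper geodesic hyperbolic space the topology seen from a single base point does not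
  depend on that point, so quantifying over all $p$ just avoids choosing one.\<close>

definition gromov_compactification :: "('a::metric_space + (real \<Rightarrow> 'a) set) topology" where
  "gromov_compactification = topology (\<lambda>U.
     U \<subseteq> range Inl \<union> Inr ` gromov_boundary \<and>
     open (Inl -` U) \<and>
     (\<forall>\<xi>. Inr \<xi> \<in> U \<longrightarrow> (\<forall>p. \<exists>r. gromov_nbhd p \<xi> r \<subseteq> U)))"

lemma gromov_nbhd_antimono: "r \<le> s \<Longrightarrow> gromov_nbhd p \<xi> s \<subseteq> gromov_nbhd p \<xi> r"
  unfolding gromov_nbhd_def by (fastforce intro: order_trans[of "ereal r" "ereal s"])

lemma openin_gromov_compactification:
  "openin gromov_compactification U \<longleftrightarrow>
     U \<subseteq> range Inl \<union> Inr ` gromov_boundary \<and>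
     open (Inl -` U) \<and>
     (\<forall>\<xi>. Inr \<xi> \<in> U \<longrightarrow> (\<forall>p. \<exists>r. gromov_nbhd p \<xi> r \<subseteq> U))"
proof -
  have "istopology (\<lambda>U::('a + (real \<Rightarrow> 'a) set) set.
     U \<subseteq> range Inl \<union> Inr ` gromov_boundary \<and>
     open (Inl -` U) \<and>
     (\<forall>\<xi>. Inr \<xi> \<in> U \<longrightarrow> (\<forall>p. \<exists>r. gromov_nbhd p \<xi> r \<subseteq> U)))" (is "istopology ?P")
    unfolding istopology_def
  proof (intro conjI allI impI)
    fix S T assume S: "?P S" and T: "?P T"
    show "S \<inter> T \<subseteq> range Inl \<union> Inr ` gromov_boundary" using S by blast
    show "open (Inl -` (S \<inter> T))" using S T by (simp add: open_Int)
    fix \<xi> p assume x: "Inr \<xi> \<in> S \<inter> T"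
    obtain r where r: "gromov_nbhd p \<xi> r \<subseteq> S" using S x by blast
    obtain s where s: "gromov_nbhd p \<xi> s \<subseteq> T" using T x by blast
    have "gromov_nbhd p \<xi> (max r s) \<subseteq> S \<inter> T"
      using r s gromov_nbhd_antimono[of r "max r s" p \<xi>]
        gromov_nbhd_antimono[of s "max r s" p \<xi>] by auto
    then show "\<exists>r. gromov_nbhd p \<xi> r \<subseteq> S \<inter> T" by blast
  next
    fix K assume K: "\<forall>U\<in>K. ?P U"
    show "\<Union>K \<subseteq> range Inl \<union> Inr ` gromov_boundary" using K by blast
    show "open (Inl -` \<Union>K)" using K by (auto simp: vimage_Union)
    fix \<xi> p assume "Inr \<xi> \<in> \<Union>K"
    then obtain U where U: "U \<in> K" "Inr \<xi> \<in> U" by blast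
    with K obtain r where "gromov_nbhd p \<xi> r \<subseteq> U" by blast
    with U show "\<exists>r. gromov_nbhd p \<xi> r \<subseteq> \<Union>K" by blast
  qed
  then show ?thesis unfolding gromov_compactification_def by simp
qed

lemma topspace_gromov_compactification:
  "topspace gromov_compactification = range Inl \<union> Inr ` gromov_boundary"
proof
  show "topspace gromov_compactification \<subseteq> range Inl \<union> Inr ` gromov_boundary"
    using openin_topspace openin_gromov_compactification by blast
  have eq: "Inl -` (range Inl \<union> Inr ` gromov_boundary :: ('a + (real \<Rightarrow> 'a) set) set) = UNIV"
    by auto
  have "openin gromov_compactification
      (range Inl \<union> Inr ` gromov_boundary :: ('a + (real \<Rightarrow> 'a) set) set)"
    unfolding openin_gromov_compactification eq by (auto simp: gromov_nbhd_def)
  then show "range Inl \<union> Inr ` gromov_boundary \<subseteq>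
      topspace (gromov_compactification :: ('a + (real \<Rightarrow> 'a) set) topology)"
    by (rule openin_subset)
qed

definition tends_to_boundary :: "(nat \<Rightarrow> 'a::metric_space) \<Rightarrow> (real \<Rightarrow> 'a) set \<Rightarrow> bool" where
  "tends_to_boundary u \<xi> \<longleftrightarrow>
     limitin gromov_compactification (\<lambda>n. Inl (u n)) (Inr \<xi>) sequentially"

text \<open>The value is $\log\lambda_{\eta,p}(g)$; the filter is $z \to \eta$ with $z$ in $X$.\<close>

definition log_dilation ::
  "('a::metric_space \<Rightarrow> 'a) \<Rightarrow> 'a \<Rightarrow> (real \<Rightarrow> 'a) set \<Rightarrow> ereal" where
  "log_dilation g p \<eta> =
     Liminf (filtercomap Inl (nhdsin gromov_compactification (Inr \<eta>)))
       (\<lambda>z. ereal (dist z p - dist (g z) p))"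

definition geodesic_region :: "(real \<Rightarrow> 'a::metric_space) \<Rightarrow> real \<Rightarrow> 'a set" where
  "geodesic_region \<gamma> R = {x. infdist x (\<gamma> ` {0..}) < R}"

definition has_geodesic_limit ::
  "('a::metric_space \<Rightarrow> 'a) \<Rightarrow> (real \<Rightarrow> 'a) set \<Rightarrow> (real \<Rightarrow> 'a) set \<Rightarrow> bool" where
  "has_geodesic_limit g \<eta> \<xi> \<longleftrightarrow>
     (\<forall>\<gamma> R u. geodesic_ray \<gamma> \<and> vertex \<gamma> = \<eta> \<and> R > 0 \<and>
        (\<forall>n. u n \<in> geodesic_region \<gamma> R) \<and> tends_to_boundary u \<eta> \<longrightarrow>
        tends_to_boundary (\<lambda>n. g (u n)) \<xi>)"

definition boundary_regular_fixed_point ::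
  "('a::metric_space \<Rightarrow> 'a) \<Rightarrow> (real \<Rightarrow> 'a) set \<Rightarrow> bool" where
  "boundary_regular_fixed_point g \<eta> \<longleftrightarrow>
     \<eta> \<in> gromov_boundary \<and> (\<forall>p. log_dilation g p \<eta> < \<infinity>) \<and> has_geodesic_limit g \<eta> \<eta>"

text \<open>Meaningful at boundary regular fixed points of a non-expanding map, where all the terms
  are finite and the limit exists.\<close>

definition stable_dilation ::
  "('a::metric_space \<Rightarrow> 'a) \<Rightarrow> 'a \<Rightarrow> (real \<Rightarrow> 'a) set \<Rightarrow> real" where
  "stable_dilation f p \<eta> =
     exp (lim (\<lambda>n. real_of_ereal (log_dilation (f ^^ n) p \<eta>) / real n))"

definition elliptic_map :: "('a::metric_space \<Rightarrow> 'a) \<Rightarrow> bool" where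
  "elliptic_map f \<longleftrightarrow> (\<exists>x. bounded (range (\<lambda>n. (f ^^ n) x)))"

definition limit_retract :: "('a::metric_space \<Rightarrow> 'a) \<Rightarrow> 'a set" where
  "limit_retract f =
     (\<Union>x. {y. \<exists>r::nat \<Rightarrow> nat. strict_mono r \<and> (\<lambda>n. (f ^^ r n) x) \<longlonglongrightarrow> y})"

definition denjoy_wolff_point :: "('a::metric_space \<Rightarrow> 'a) \<Rightarrow> (real \<Rightarrow> 'a) set \<Rightarrow> bool" where
  "denjoy_wolff_point f \<zeta> \<longleftrightarrow>
     \<zeta> \<in> gromov_boundary \<and> (\<forall>x. tends_to_boundary (\<lambda>n. (f ^^ n) x) \<zeta>)"

definition hyperbolic_map :: "('a::metric_space \<Rightarrow> 'a) \<Rightarrow> bool" where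
  "hyperbolic_map f \<longleftrightarrow>
     \<not> elliptic_map f \<and> (\<exists>\<zeta>. denjoy_wolff_point f \<zeta> \<and> (\<forall>p. stable_dilation f p \<zeta> < 1))"

end

theory Submission
  imports Defs
begin

text \<open>Fix a ray \<open>\<gamma>\<close> towards \<open>\<eta>\<close> and work coarsely, with constants depending on the space only. A
  non-expanding map \<open>g\<close> has \<open>\<eta>\<close> as a boundary regular fixed point iff it moves the points of \<open>\<gamma>\<close>
  a bounded distance, and then it acts on the far end of \<open>\<gamma>\<close> almost as a translation, whose length
  is \<open>log_dilation g p \<eta>\<close> up to a bounded error. Hence \<open>n \<mapsto> log_dilation (f\<^sup>n) p \<eta>\<close> is quasi-additive and
  stays within bounded distance of \<open>n \<cdot> log \<Lambda>\<close>. Julia's lemma then drives orbits to \<open>\<eta>\<close> if \<open>\<Lambda> < 1\<close>, or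
  if \<open>\<Lambda> \<le> 1\<close> and orbits escape. For elliptic \<open>f\<close> with \<open>\<Lambda> = 1\<close> the orbit of a far point of \<open>\<gamma>\<close> stays
  close to \<open>\<eta>\<close> and so do its limit points; conversely, the recurrence of points of the limit retract
  close to \<open>\<eta>\<close> bounds all \<open>log_dilation (f\<^sup>n) p \<eta>\<close> from above.\<close>

section \<open>Gromov products\<close>

text \<open>\<open>log_dilation\<close> is a lower limit over all approaches to the vertex and hard
  to compose. It is traded for \<open>total_retreat\<close>, a supremum along one ray. The bound on
  how far an iterate moves the ray may grow with the iterate, so it cannot serve as the error when
  retreats are added; the error in \<open>total_retreat_comp\<close> must not depend on the maps.
  The case of stable dilation 1 is the delicate one. In Julia's lemma the depth gained is half of
  the distance of the orbit from the base point minus the retreat. If the retreats are merely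
  bounded, the distance must tend to infinity, whereas non-ellipticity only says that it is
  unbounded. Calka's argument closes this gap. The sets \<open>gromov_nbhd\<close> need not be open,
  so each must first be shown to contain an open set around its centre. After that, filter, limit
  and closure at a boundary point are expressed by the single function
  \<open>ray_product\<close>.\<close>

lemma gromov_product_commute: "gromov_product p x y = gromov_product p y x"
  by (simp add: gromov_product_def dist_commute)

lemma gromov_product_le: "gromov_product p x y \<le> dist y p" "gromov_product p x y \<le> dist x p"
  using dist_triangle[of x p y] dist_triangle[of y p x] dist_commute[of y x]
  by (simp_all add: gromov_product_def)

lemma gromov_product_lipschitz: "gromov_product p x y - dist y z \<le> gromov_product p x z"
  using dist_triangle[of x z y] dist_triangle[of y p z]
  unfolding gromov_product_def by argo

lemma gromov_product_basepoint: "gromov_product p x y - dist p q \<le> gromov_product q x y"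
  using dist_triangle[of x p q] dist_triangle[of y p q] dist_commute[of p q]
  unfolding gromov_product_def by argo

lemma dist_eq_gromov_product: "dist x y = dist x p + dist y p - 2 * gromov_product p x y"
  by (simp add: gromov_product_def field_simps)

lemma gromov_product_le_dist_between:
  assumes "dist x a + dist a y = dist x y"
  shows "gromov_product p x y \<le> dist p a"
  using assms dist_triangle[of x p a] dist_triangle[of y p a] dist_commute[of p a] dist_commute[of y a]
  unfolding gromov_product_def by argo

section \<open>Geodesic segments and the four-point inequality\<close>

lemma geodesic_segment_between:
  assumes "geodesic_segment x y S" "a \<in> S"
  shows "dist x a + dist a y = dist x y"
proof -
  obtain c where c: "c 0 = x" "c (dist x y) = y"
    "\<forall>s\<in>{0..dist x y}. \<forall>t\<in>{0..dist x y}. dist (c s) (c t) = \<bar>s - t\<bar>" "S = c ` {0..dist x y}"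
    using assms(1) unfolding geodesic_segment_def by blast
  obtain s where s: "a = c s" "s \<in> {0..dist x y}" using assms(2) c(4) by blast
  have "dist (c 0) (c s) = s" "dist (c s) (c (dist x y)) = dist x y - s"
    using c(3) s(2) by auto
  then show ?thesis using c s by simp
qed

lemma geodesic_segment_ends:
  assumes "geodesic_segment x y S"
  shows "x \<in> S" "y \<in> S"
proof -
  obtain c where c: "c 0 = x" "c (dist x y) = y" "S = c ` {0..dist x y}"
    using assms unfolding geodesic_segment_def by blast
  have "c 0 \<in> S" "c (dist x y) \<in> S" unfolding c(3) by (rule imageI, simp)+
  then show "x \<in> S" "y \<in> S" using c by simp_all
qed

lemma connected_geodesic_segment:
  assumes "geodesic_segment x y S"
  shows "connected S"
proof -
  obtain c where c: "S = c ` {0..dist x y}"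
    "\<forall>s\<in>{0..dist x y}. \<forall>t\<in>{0..dist x y}. dist (c s) (c t) = \<bar>s - t\<bar>"
    using assms unfolding geodesic_segment_def by blast
  have "continuous_on {0..dist x y} c"
    unfolding continuous_on_iff
  proof (intro ballI allI impI)
    fix s e :: real assume "s \<in> {0..dist x y}" "e > 0"
    then show "\<exists>d>0. \<forall>t\<in>{0..dist x y}. dist t s < d \<longrightarrow> dist (c t) (c s) < e"
      using c(2) by (intro exI[of _ e]) (auto simp: dist_real_def)
  qed
  then show ?thesis unfolding c(1) by (intro connected_continuous_image) auto
qed

lemma infdist_lessD:
  assumes "infdist x A < r" "A \<noteq> {}"
  obtains a where "a \<in> A" "dist x a < r"
proof -
  have "bdd_below (dist x ` A)" by (auto simp: bdd_below_def intro!: exI[of _ 0])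
  then show ?thesis using assms that by (auto simp: infdist_notempty cINF_less_iff)
qed

text \<open>By slimness each side has a point whose distance to \<open>p\<close> is at most the
  product of its ends plus \<open>2 * \<delta>\<close>. On the side from \<open>x\<close> to
  \<open>z\<close> this point is \<delta>-close to another side, whose points are at least as far
  from \<open>p\<close> as the product of its ends. Hence the constant
  \<open>3 * \<delta>\<close>.\<close>

lemma four_point_inequality:
  assumes geo: "geodesic_space TYPE('a::metric_space)"
    and hyp: "gromov_hyperbolic_space TYPE('a)"
  shows "\<exists>K. \<forall>p x y z :: 'a.
    min (gromov_product p x y) (gromov_product p y z) - K \<le> gromov_product p x z"
proof -
  obtain \<delta> where \<delta>: "\<delta> > 0"
    and slim: "\<forall>(x::'a) y z A B C. geodesic_segment x y A \<longrightarrow> geodesic_segment y z B \<longrightarrow>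
      geodesic_segment z x C \<longrightarrow> (\<forall>a\<in>A. infdist a (B \<union> C) < \<delta>)"
    using hyp unfolding gromov_hyperbolic_space_def by (elim exE conjE) (rule that)
  have near: "\<exists>b\<in>B \<union> C. dist a b < \<delta>"
    if "geodesic_segment x y A" "geodesic_segment y z B" "geodesic_segment z x C" "a \<in> A"
    for x y z a :: 'a and A B C
  proof -
    have "B \<union> C \<noteq> {}" using geodesic_segment_ends[OF that(2)] by blast
    moreover have "infdist a (B \<union> C) < \<delta>" using slim that by simp
    ultimately show ?thesis by (metis infdist_lessD)
  qed
  have seg: "\<exists>S. geodesic_segment x y S" for x y :: 'a
    using geo unfolding geodesic_space_def by blast
  \<comment> \<open>\<open>A\<close> is connected and covered by the open \<delta>-neighbourhoods of
    the other two sides, each of which contains an end of \<open>A\<close>. So some \<open>m\<close>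
    in \<open>A\<close> is close to both.\<close>
  have mid: "\<exists>m\<in>A. dist p m \<le> gromov_product p x y + 2 * \<delta>"
    if A: "geodesic_segment x y A" for x y p :: 'a and A
  proof -
    obtain B C where B: "geodesic_segment y p B" and C: "geodesic_segment p x C"
      using seg by blast
    let ?U = "\<Union>b\<in>B. ball b \<delta>" and ?V = "\<Union>c\<in>C. ball c \<delta>"
    have cover: "A \<subseteq> ?U \<union> ?V"
    proof
      fix a assume "a \<in> A"
      then obtain b where "b \<in> B \<union> C" "dist b a < \<delta>" using near[OF A B C] dist_commute by metis
      then show "a \<in> ?U \<union> ?V" by auto
    qed
    have "y \<in> ball y \<delta>" "x \<in> ball x \<delta>" using \<delta> by simp_all
    then have "y \<in> ?U" "x \<in> ?V"
      using geodesic_segment_ends[OF B] geodesic_segment_ends[OF C] by blast+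
    then have "?U \<inter> A \<noteq> {}" "?V \<inter> A \<noteq> {}"
      using geodesic_segment_ends[OF A] by blast+
    moreover have "open ?U" "open ?V" by auto
    ultimately have "?U \<inter> ?V \<inter> A \<noteq> {}"
      using connectedD[OF connected_geodesic_segment[OF A] _ _ _ cover] by metis
    then obtain m where "m \<in> A" "m \<in> ?U" "m \<in> ?V" by blast
    then obtain b c where m: "m \<in> A" "b \<in> B" "dist b m < \<delta>" "c \<in> C" "dist c m < \<delta>"
      by auto
    have "dist y b + dist b p = dist y p" "dist p c + dist c x = dist p x"
      using geodesic_segment_between[OF B m(2)] geodesic_segment_between[OF C m(4)] .
    moreover have "dist x m + dist m y = dist x y" using geodesic_segment_between[OF A m(1)] .
    moreover have "dist y m \<le> dist y b + dist b m" "dist p m \<le> dist b p + dist b m"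
      "dist x m \<le> dist c x + dist c m" "dist p m \<le> dist p c + dist c m"
      using dist_triangle[of y m b] dist_triangle[of p m b] dist_triangle[of x m c]
        dist_triangle[of p m c] by (simp_all add: dist_commute)
    ultimately have "2 * dist p m \<le> dist x p + dist y p - dist x y + 4 * \<delta>"
      using m(3,5) dist_commute[of m y] dist_commute[of p x] dist_commute[of x c] by linarith
    then have "dist p m \<le> gromov_product p x y + 2 * \<delta>"
      by (simp add: gromov_product_def field_simps)
    with m(1) show ?thesis by blast
  qed
  have "min (gromov_product p x y) (gromov_product p y z) - 3 * \<delta> \<le> gromov_product p x z"
    for p x y z :: 'a
  proof -
    obtain A B C where S: "geodesic_segment x z A" "geodesic_segment z y B" "geodesic_segment y x C"
      using seg by blast
    obtain m where m: "m \<in> A" "dist p m \<le> gromov_product p x z + 2 * \<delta>"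
      using mid[OF S(1)] by blast
    obtain b where b: "b \<in> B \<union> C" "dist m b < \<delta>" using near[OF S m(1)] by blast
    have "b \<in> B \<Longrightarrow> gromov_product p z y \<le> dist p b" "b \<in> C \<Longrightarrow> gromov_product p y x \<le> dist p b"
      by (rule gromov_product_le_dist_between, erule geodesic_segment_between[OF S(2)])
        (rule gromov_product_le_dist_between, erule geodesic_segment_between[OF S(3)])
    then have "min (gromov_product p x y) (gromov_product p y z) \<le> dist p b"
      using b(1) gromov_product_commute[of p x y] gromov_product_commute[of p y z] by auto
    also have "\<dots> \<le> dist p m + dist m b" by (rule dist_triangle)
    finally show ?thesis using m(2) b(2) by simp
  qed
  then show ?thesis by (intro exI[of _ "3 * \<delta>"] allI)
qed

section \<open>Geodesic rays\<close>

lemma geodesic_rayD: "geodesic_ray \<gamma> \<Longrightarrow> 0 \<le> s \<Longrightarrow> 0 \<le> t \<Longrightarrow> dist (\<gamma> s) (\<gamma> t) = \<bar>s - t\<bar>"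
  by (simp add: geodesic_ray_def)

lemma dist_geodesic_ray_start: "geodesic_ray \<gamma> \<Longrightarrow> 0 \<le> t \<Longrightarrow> dist (\<gamma> t) (\<gamma> 0) = t"
  by (simp add: geodesic_rayD)

lemma equiv_asymptotic_rays: "equiv (Collect geodesic_ray) asymptotic_rays"
proof (rule equivI)
  show "asymptotic_rays \<subseteq> Collect geodesic_ray \<times> Collect geodesic_ray"
    by (auto simp: asymptotic_rays_def)
  show "refl_on (Collect geodesic_ray) asymptotic_rays"
    by (auto simp: refl_on_def asymptotic_rays_def)
  show "sym asymptotic_rays"
    by (auto simp: sym_def asymptotic_rays_def dist_commute)
  show "trans asymptotic_rays"
  proof (rule transI)
    fix a b c assume ab: "(a, b) \<in> asymptotic_rays" and bc: "(b, c) \<in> asymptotic_rays"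
    obtain C D where "geodesic_ray a" "geodesic_ray c"
      "\<forall>t\<ge>0. dist (a t) (b t) \<le> C" "\<forall>t\<ge>0. dist (b t) (c t) \<le> D"
      using ab bc by (auto simp: asymptotic_rays_def)
    moreover from this have "\<forall>t\<ge>0. dist (a t) (c t) \<le> C + D"
      by (meson add_mono dist_triangle order_trans)
    ultimately show "(a, c) \<in> asymptotic_rays"
      by (auto simp: asymptotic_rays_def)
  qed
qed

lemma vertex_in_boundary: "geodesic_ray \<gamma> \<Longrightarrow> vertex \<gamma> \<in> gromov_boundary"
  unfolding vertex_def gromov_boundary_def by (auto intro: quotientI)

lemma in_vertex_self: "geodesic_ray \<gamma> \<Longrightarrow> \<gamma> \<in> vertex \<gamma>"
  by (auto simp: vertex_def asymptotic_rays_def)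

lemma boundary_cases:
  assumes "\<xi> \<in> gromov_boundary"
  obtains \<gamma> where "geodesic_ray \<gamma>" "\<xi> = vertex \<gamma>"
  using assms unfolding vertex_def gromov_boundary_def by (auto elim: quotientE)

lemma vertex_eq: "(\<gamma>, \<sigma>) \<in> asymptotic_rays \<Longrightarrow> vertex \<gamma> = vertex \<sigma>"
  unfolding vertex_def using equiv_asymptotic_rays by (rule equiv_class_eq)

lemma in_vertexD:
  assumes "\<sigma> \<in> vertex \<gamma>"
  shows "(\<gamma>, \<sigma>) \<in> asymptotic_rays" "geodesic_ray \<sigma>" "vertex \<sigma> = vertex \<gamma>"
  using assms vertex_eq[of \<gamma> \<sigma>] by (auto simp: vertex_def asymptotic_rays_def)

lemma asymptotic_raysD:
  assumes "(\<gamma>, \<sigma>) \<in> asymptotic_rays"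
  obtains C where "geodesic_ray \<gamma>" "geodesic_ray \<sigma>" "\<And>t. t \<ge> 0 \<Longrightarrow> dist (\<gamma> t) (\<sigma> t) \<le> C"
  using assms by (auto simp: asymptotic_rays_def)

lemma dist_geodesic_ray_ge: "geodesic_ray \<gamma> \<Longrightarrow> 0 \<le> t \<Longrightarrow> t - dist (\<gamma> 0) p \<le> dist (\<gamma> t) p"
  using dist_triangle[of "\<gamma> t" "\<gamma> 0" p] dist_geodesic_ray_start[of \<gamma> t]
  by (simp add: dist_commute)

lemma gromov_product_asymptotic_rays:
  assumes "(\<gamma>, \<sigma>) \<in> asymptotic_rays"
  shows "filterlim (\<lambda>t. gromov_product p (\<gamma> t) (\<sigma> t)) at_top at_top"
proof -
  obtain C where C: "geodesic_ray \<gamma>" "geodesic_ray \<sigma>" "\<And>t. t \<ge> 0 \<Longrightarrow> dist (\<gamma> t) (\<sigma> t) \<le> C"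
    using asymptotic_raysD[OF assms] by blast
  define D where "D = (dist (\<gamma> 0) p + dist (\<sigma> 0) p + C) / 2"
  have ge: "gromov_product p (\<gamma> t) (\<sigma> t) \<ge> t - D" if "t \<ge> 0" for t
    using dist_geodesic_ray_ge[OF C(1) that, of p] dist_geodesic_ray_ge[OF C(2) that, of p]
      C(3)[OF that] by (simp add: gromov_product_def D_def field_simps)
  show ?thesis unfolding filterlim_at_top
  proof
    fix Z :: real
    have "\<forall>\<^sub>F t in at_top. t \<ge> max 0 (Z + D)" by (rule eventually_ge_at_top)
    then show "\<forall>\<^sub>F t in at_top. Z \<le> gromov_product p (\<gamma> t) (\<sigma> t)"
      by eventually_elim (use ge in fastforce)
  qed
qed

text \<open>Advancing along the ray raises the distance to \<open>\<gamma> 0\<close> at full speed,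
  the distance to \<open>y\<close> at most as fast. Hence the lower limits in
  \<open>gromov_nbhd\<close> are suprema for points of the space.\<close>

lemma gromov_product_ray_mono:
  assumes "geodesic_ray \<gamma>" "0 \<le> s" "s \<le> t"
  shows "gromov_product (\<gamma> 0) (\<gamma> s) y \<le> gromov_product (\<gamma> 0) (\<gamma> t) y"
proof -
  have "dist (\<gamma> t) y \<le> (t - s) + dist (\<gamma> s) y"
    using dist_triangle[of "\<gamma> t" y "\<gamma> s"] geodesic_rayD[OF assms(1), of t s] assms(2,3) by simp
  then show ?thesis
    using dist_geodesic_ray_start[OF assms(1), of s] dist_geodesic_ray_start[OF assms(1), of t]
      assms(2,3) by (simp add: gromov_product_def)
qed

lemma gromov_product_on_ray:
  assumes "geodesic_ray \<gamma>" "0 \<le> s" "0 \<le> t"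
  shows "gromov_product (\<gamma> 0) (\<gamma> s) (\<gamma> t) = min s t"
  using assms dist_geodesic_ray_start[OF assms(1), of s] dist_geodesic_ray_start[OF assms(1), of t]
    geodesic_rayD[OF assms]
  by (simp add: gromov_product_def min_def abs_if)

text \<open>The Gromov product of \<open>y\<close> with the end of \<open>\<gamma>\<close>; for a
  geodesic ray, half the difference of \<open>dist y (\<gamma> 0)\<close> and the Busemann function
  of \<open>\<gamma>\<close> at \<open>y\<close>. It is a function of the ray and not of its class,
  so that it is exactly \<open>t\<close> at \<open>\<gamma> t\<close>.\<close>

definition ray_product :: "(real \<Rightarrow> 'a::metric_space) \<Rightarrow> 'a \<Rightarrow> real" where
  "ray_product \<gamma> y = (SUP t\<in>{0..}. gromov_product (\<gamma> 0) (\<gamma> t) y)"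

lemma bdd_above_gromov_product: "bdd_above ((\<lambda>t. gromov_product p (\<gamma> t) y) ` A)"
  using gromov_product_le(1) by (auto simp: bdd_above_def)

lemma ray_product_upper: "0 \<le> t \<Longrightarrow> gromov_product (\<gamma> 0) (\<gamma> t) y \<le> ray_product \<gamma> y"
  unfolding ray_product_def by (intro cSUP_upper bdd_above_gromov_product) auto

lemma ray_product_least:
  "(\<And>t. 0 \<le> t \<Longrightarrow> gromov_product (\<gamma> 0) (\<gamma> t) y \<le> c) \<Longrightarrow> ray_product \<gamma> y \<le> c"
  unfolding ray_product_def by (intro cSUP_least) auto

lemma ray_product_approx:
  assumes "c < ray_product \<gamma> y"
  obtains t where "0 \<le> t" "c < gromov_product (\<gamma> 0) (\<gamma> t) y"
  using assms unfolding ray_product_def by (auto simp: less_cSUP_iff bdd_above_gromov_product)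

lemma ray_product_le_dist: "ray_product \<gamma> y \<le> dist y (\<gamma> 0)"
  by (intro ray_product_least gromov_product_le)

lemma ray_product_lipschitz: "ray_product \<gamma> y - dist y z \<le> ray_product \<gamma> z"
proof -
  have "ray_product \<gamma> y \<le> ray_product \<gamma> z + dist y z"
  proof (rule ray_product_least)
    fix t :: real assume "0 \<le> t"
    then show "gromov_product (\<gamma> 0) (\<gamma> t) y \<le> ray_product \<gamma> z + dist y z"
      using ray_product_upper[of t \<gamma> z] gromov_product_lipschitz[of "\<gamma> 0" "\<gamma> t" y z] by linarith
  qed
  then show ?thesis by simp
qed

lemma ray_product_on_ray:
  assumes "geodesic_ray \<gamma>" "0 \<le> t"
  shows "ray_product \<gamma> (\<gamma> t) = t"
proof (rule antisym)
  show "ray_product \<gamma> (\<gamma> t) \<le> t"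
    using ray_product_le_dist[of \<gamma> "\<gamma> t"] dist_geodesic_ray_start[OF assms] by simp
  show "t \<le> ray_product \<gamma> (\<gamma> t)"
    using ray_product_upper[OF assms(2), of \<gamma> "\<gamma> t"] gromov_product_on_ray[OF assms(1,2,2)] by simp
qed

lemma tendsto_ray_product:
  assumes "geodesic_ray \<gamma>"
  shows "((\<lambda>t. gromov_product (\<gamma> 0) (\<gamma> t) y) \<longlongrightarrow> ray_product \<gamma> y) at_top"
proof (rule order_tendstoI)
  fix a assume "a < ray_product \<gamma> y"
  then obtain s where s: "0 \<le> s" "a < gromov_product (\<gamma> 0) (\<gamma> s) y"
    by (rule ray_product_approx)
  show "\<forall>\<^sub>F t in at_top. a < gromov_product (\<gamma> 0) (\<gamma> t) y"
    using eventually_ge_at_top[of s]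
    by eventually_elim (use s(2) gromov_product_ray_mono[OF assms s(1)] less_le_trans in blast)
next
  fix a assume a: "ray_product \<gamma> y < a"
  show "\<forall>\<^sub>F t in at_top. gromov_product (\<gamma> 0) (\<gamma> t) y < a"
    using eventually_ge_at_top[of "0::real"]
    by eventually_elim (use a ray_product_upper le_less_trans in blast)
qed

lemma Liminf_gromov_product_ray:
  assumes "geodesic_ray \<gamma>"
  shows "Liminf at_top (\<lambda>t. ereal (gromov_product (\<gamma> 0) (\<gamma> t) y)) = ereal (ray_product \<gamma> y)"
  using tendsto_ray_product[OF assms] by (intro lim_imp_Liminf) auto

lemma gromov_nbhd_Inl_iff:
  assumes "\<xi> \<in> gromov_boundary"
  shows "Inl y \<in> gromov_nbhd p \<xi> r \<longleftrightarrow> (\<exists>\<gamma>\<in>\<xi>. \<gamma> 0 = p \<and> r \<le> ray_product \<gamma> y)"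
proof -
  have "geodesic_ray \<gamma>" if "\<gamma> \<in> \<xi>" for \<gamma>
    using boundary_cases[OF assms] in_vertexD(2) that by metis
  then have "ereal r \<le> Liminf at_top (\<lambda>t. ereal (gromov_product (\<gamma> 0) (\<gamma> t) y)) \<longleftrightarrow> r \<le> ray_product \<gamma> y"
    if "\<gamma> \<in> \<xi>" for \<gamma> using that by (simp add: Liminf_gromov_product_ray)
  then show ?thesis unfolding gromov_nbhd_def by blast
qed

lemma gromov_nbhd_Inr_iff:
  "Inr \<zeta> \<in> gromov_nbhd p \<xi> r \<longleftrightarrow> \<zeta> \<in> gromov_boundary \<and> (\<exists>\<gamma>\<in>\<xi>. \<exists>\<sigma>\<in>\<zeta>. \<gamma> 0 = p \<and> \<sigma> 0 = p \<and>
     ereal r \<le> Liminf at_top (\<lambda>t. ereal (gromov_product p (\<gamma> t) (\<sigma> t))))"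
  by (auto simp: gromov_nbhd_def)

lemma asymptotic_raysI:
  assumes "geodesic_ray \<gamma>" "geodesic_ray \<sigma>"
    and ge: "\<And>t. 0 \<le> t \<Longrightarrow> t - D \<le> gromov_product p (\<gamma> t) (\<sigma> t)"
  shows "(\<gamma>, \<sigma>) \<in> asymptotic_rays"
proof -
  have "dist (\<gamma> t) (\<sigma> t) \<le> dist (\<gamma> 0) p + dist (\<sigma> 0) p + 2 * D" if "0 \<le> t" for t
    using dist_eq_gromov_product[of "\<gamma> t" "\<sigma> t" p] ge[OF that]
      dist_triangle[of "\<gamma> t" p "\<gamma> 0"] dist_triangle[of "\<sigma> t" p "\<sigma> 0"]
      dist_geodesic_ray_start[OF assms(1) that] dist_geodesic_ray_start[OF assms(2) that] by linarith
  then show ?thesis using assms(1,2) by (auto simp: asymptotic_rays_def)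
qed

text \<open>Arzela-Ascoli by way of Tychonoff: the geodesics from \<open>p\<close> to
  \<open>x n\<close> are points of a product of compact balls, and \<open>\<gamma>\<close> is a
  cluster point. No subsequence is extracted from this uncountable product; closeness holds
  frequently, for two parameters at a time.\<close>

lemma ray_limit:
  fixes x :: "nat \<Rightarrow> 'a::metric_space"
  assumes proper: "proper_space TYPE('a)" and geo: "geodesic_space TYPE('a)"
    and lim: "filterlim (\<lambda>n. dist p (x n)) at_top sequentially"
  obtains \<gamma> where "geodesic_ray \<gamma>" "\<gamma> 0 = p"
    "\<And>t. 0 \<le> t \<Longrightarrow> \<exists>\<^sub>F n in sequentially. t - 1 \<le> gromov_product p (\<gamma> t) (x n)"
proof -
  have "\<forall>n. \<exists>c. c 0 = p \<and> c (dist p (x n)) = x n \<and>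
      (\<forall>s\<in>{0..dist p (x n)}. \<forall>t\<in>{0..dist p (x n)}. dist (c s) (c t) = \<bar>s - t\<bar>)"
    using geo unfolding geodesic_space_def geodesic_segment_def by blast
  then obtain c where c: "\<And>n. c n 0 = p" "\<And>n. c n (dist p (x n)) = x n"
    "\<And>n s t. \<lbrakk>s \<in> {0..dist p (x n)}; t \<in> {0..dist p (x n)}\<rbrakk> \<Longrightarrow> dist (c n s) (c n t) = \<bar>s - t\<bar>"
    by metis
  \<comment> \<open>The default value \<open>p\<close> keeps \<open>k n t\<close> in the ball of
    radius \<open>\<bar>t\<bar>\<close> also outside the domain of the geodesic.\<close>
  define k where "k n t = (if 0 \<le> t \<and> t \<le> dist p (x n) then c n t else p)" for n t
  have k_eq: "\<forall>\<^sub>F n in sequentially. t \<le> dist p (x n) \<and> k n t = c n t" if "0 \<le> t" for t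
  proof -
    have "\<forall>\<^sub>F n in sequentially. t \<le> dist p (x n)" using lim by (simp add: filterlim_at_top)
    then show ?thesis by eventually_elim (simp add: k_def that)
  qed
  define C where "C = PiE UNIV (\<lambda>t. cball p \<bar>t\<bar>)"
  have "compactin (product_topology (\<lambda>_. euclidean) UNIV) C"
    using proper unfolding C_def by (subst compactin_PiE) (simp add: proper_space_def)
  then have "compact C" by (simp add: euclidean_product_topology)
  moreover have "k n \<in> C" for n
    using c(3)[of 0 n] by (auto simp: C_def k_def c(1))
  moreover have "filtermap k sequentially \<noteq> bot" by (simp add: filtermap_bot_iff)
  ultimately obtain \<gamma> where \<gamma>: "\<gamma> \<in> C" "inf (nhds \<gamma>) (filtermap k sequentially) \<noteq> bot"
    unfolding compact_filter by (metis (mono_tags, lifting) always_eventually eventually_filtermap)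
  have freq: "\<exists>\<^sub>F n in sequentially. P n \<and> dist (k n s) (\<gamma> s) < e \<and> dist (k n t) (\<gamma> t) < e"
    if "e > 0" "eventually P sequentially" for e s t and P
  proof (rule ccontr)
    let ?V = "{g. dist (g s) (\<gamma> s) < e \<and> dist (g t) (\<gamma> t) < e}"
    assume "\<not> ?thesis"
    then have "\<forall>\<^sub>F n in sequentially. \<not> (P n \<and> k n \<in> ?V)" by (simp add: not_frequently)
    with that(2) have "\<forall>\<^sub>F n in sequentially. k n \<notin> ?V" by eventually_elim blast
    moreover have "open ?V"
      by (intro open_Collect_conj open_Collect_less continuous_intros continuous_on_dist
          continuous_on_product_coordinates)
    then have "eventually (\<lambda>g. g \<in> ?V) (nhds \<gamma>)"
      using that(1) by (intro eventually_nhds_in_open) auto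
    ultimately have "eventually (\<lambda>g. False) (inf (nhds \<gamma>) (filtermap k sequentially))"
      unfolding eventually_inf eventually_filtermap
      by (intro exI[of _ "\<lambda>g. g \<in> ?V"] exI[of _ "\<lambda>g. g \<notin> ?V"]) simp
    with \<gamma>(2) show False by (simp add: eventually_False)
  qed
  have "\<gamma> 0 \<in> cball p 0" using \<gamma>(1) by (auto simp: C_def PiE_iff dest!: spec[of _ 0])
  then have start: "\<gamma> 0 = p" by simp
  have dist_\<gamma>: "\<bar>dist (\<gamma> s) (\<gamma> t) - \<bar>s - t\<bar>\<bar> < e" if "0 \<le> s" "0 \<le> t" "e > 0" for s t e
  proof -
    have ev: "\<forall>\<^sub>F n in sequentially. dist (k n s) (k n t) = \<bar>s - t\<bar>"
      using k_eq[OF that(1)] k_eq[OF that(2)] by eventually_elim (use that c(3) in auto)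
    have "e / 2 > 0" using that by simp
    from freq[OF this ev] obtain n where
      "dist (k n s) (k n t) = \<bar>s - t\<bar>" "dist (k n s) (\<gamma> s) < e / 2" "dist (k n t) (\<gamma> t) < e / 2"
      using frequently_ex by blast
    then show ?thesis
      using dist_triangle[of "\<gamma> s" "\<gamma> t" "k n s"] dist_triangle[of "k n s" "\<gamma> t" "k n t"]
        dist_triangle[of "k n s" "k n t" "\<gamma> s"] dist_triangle[of "\<gamma> s" "k n t" "\<gamma> t"]
      by (simp add: dist_commute abs_less_iff)
  qed
  \<comment> \<open>The error is taken to be the defect itself: were it positive, it would be
    smaller than itself.\<close>
  have "dist (\<gamma> s) (\<gamma> t) = \<bar>s - t\<bar>" if "0 \<le> s" "0 \<le> t" for s t
    using dist_\<gamma>[OF that, of "\<bar>dist (\<gamma> s) (\<gamma> t) - \<bar>s - t\<bar>\<bar>"] by linarith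
  then have ray: "geodesic_ray \<gamma>" by (simp add: geodesic_ray_def)
  have "\<exists>\<^sub>F n in sequentially. t - 1 \<le> gromov_product p (\<gamma> t) (x n)" if t: "0 \<le> t" for t
    using freq[OF zero_less_one k_eq[OF t], of t t]
  proof (rule frequently_elim1)
    fix n assume n: "(t \<le> dist p (x n) \<and> k n t = c n t) \<and> dist (k n t) (\<gamma> t) < 1 \<and> dist (k n t) (\<gamma> t) < 1"
    have "dist (c n 0) (c n t) = t" "dist (c n t) (c n (dist p (x n))) = dist p (x n) - t"
      using c(3)[of 0 n t] c(3)[of t n "dist p (x n)"] n t by auto
    then have "gromov_product p (x n) (c n t) = t"
      by (simp add: c(1,2) gromov_product_def dist_commute)
    moreover have "dist (c n t) (\<gamma> t) < 1" using n by metis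
    ultimately show "t - 1 \<le> gromov_product p (\<gamma> t) (x n)"
      using gromov_product_lipschitz[of p "x n" "c n t" "\<gamma> t"]
        gromov_product_commute[of p "\<gamma> t" "x n"] by linarith
  qed
  with ray start show ?thesis by (rule that)
qed

text \<open>Gromov's form of hyperbolicity. From here on the hyperbolicity of the space enters
  through this inequality.\<close>

locale four_point_space =
  fixes X :: "'a::metric_space itself" and K :: real
  assumes four_point: "\<And>p x y z :: 'a.
    min (gromov_product p x y) (gromov_product p y z) - K \<le> gromov_product p x z"
begin

lemma K_nonneg: "0 \<le> K"
  using four_point[of undefined undefined undefined undefined] by (simp add: gromov_product_def)

text \<open>The four-point inequality with the end of \<open>\<gamma>\<close> as a vertex, for the
  same \<open>K\<close>: it suffices to apply it at one \<open>t\<close> that almost attains the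
  supremum for \<open>y\<close>.\<close>

lemma ray_product_ge:
  fixes x y :: 'a
  shows "min (gromov_product (\<gamma> 0) x y) (ray_product \<gamma> y) - K \<le> ray_product \<gamma> x"
proof (rule ccontr)
  assume *: "\<not> ?thesis"
  then have "ray_product \<gamma> x + K < ray_product \<gamma> y" by simp
  then obtain t where t: "0 \<le> t" "ray_product \<gamma> x + K < gromov_product (\<gamma> 0) (\<gamma> t) y"
    by (rule ray_product_approx)
  then show False
    using * four_point[of "\<gamma> 0" x y "\<gamma> t"] ray_product_upper[OF t(1), of \<gamma> x]
    by (simp add: gromov_product_commute)
qed

text \<open>Here the end of the ray is the middle vertex, so one \<open>t\<close> has to serve
  \<open>x\<close> and \<open>y\<close> at once; this is why the supremum must be a limit.\<close>

lemma gromov_product_ge_ray_product: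
  fixes x y :: 'a
  assumes "geodesic_ray \<gamma>"
  shows "min (ray_product \<gamma> x) (ray_product \<gamma> y) - K \<le> gromov_product (\<gamma> 0) x y"
proof (rule ccontr)
  let ?c = "gromov_product (\<gamma> 0) x y + K"
  assume "\<not> ?thesis"
  then have "?c < ray_product \<gamma> x" "?c < ray_product \<gamma> y" by simp_all
  then have "\<forall>\<^sub>F t in at_top. ?c < gromov_product (\<gamma> 0) (\<gamma> t) x"
    "\<forall>\<^sub>F t in at_top. ?c < gromov_product (\<gamma> 0) (\<gamma> t) y"
    by (auto intro: order_tendstoD(1)[OF tendsto_ray_product[OF assms]])
  then have "\<forall>\<^sub>F t in at_top. ?c < gromov_product (\<gamma> 0) (\<gamma> t) x \<and> ?c < gromov_product (\<gamma> 0) (\<gamma> t) y"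
    by (rule eventually_conj)
  then obtain t where "?c < gromov_product (\<gamma> 0) (\<gamma> t) x" "?c < gromov_product (\<gamma> 0) (\<gamma> t) y"
    by (auto simp: eventually_at_top_linorder)
  then show False
    using four_point[of "\<gamma> 0" x "\<gamma> t" y] by (simp add: gromov_product_commute)
qed

text \<open>\<open>gromov_nbhd\<close> admits any ray of the class, so rays must be exchangeable.
  The product of \<open>\<gamma> t\<close> and \<open>\<sigma> t\<close> tends to infinity and drops
  out of the minimum in the four-point inequality.\<close>

lemma ray_product_asymptotic:
  fixes y :: 'a
  assumes "(\<gamma>, \<sigma>) \<in> asymptotic_rays" "\<gamma> 0 = \<sigma> 0"
  shows "ray_product \<sigma> y - K \<le> ray_product \<gamma> y"
proof (rule ccontr)
  let ?c = "ray_product \<gamma> y + K"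
  have ray: "geodesic_ray \<gamma>" "geodesic_ray \<sigma>" using assms(1) by (auto simp: asymptotic_rays_def)
  assume "\<not> ?thesis"
  then have "?c < ray_product \<sigma> y" by simp
  then have "\<forall>\<^sub>F t in at_top. ?c < gromov_product (\<sigma> 0) (\<sigma> t) y"
    by (rule order_tendstoD(1)[OF tendsto_ray_product[OF ray(2)]])
  moreover have "\<forall>\<^sub>F t in at_top. ?c < gromov_product (\<sigma> 0) (\<gamma> t) (\<sigma> t)"
    using gromov_product_asymptotic_rays[OF assms(1)] by (simp add: filterlim_at_top_dense)
  moreover have "\<forall>\<^sub>F t::real in at_top. 0 \<le> t" by (rule eventually_ge_at_top)
  ultimately have "\<forall>\<^sub>F t::real in at_top. False"
  proof eventually_elim
    case (elim t)
    then show False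
      using four_point[of "\<sigma> 0" "\<gamma> t" "\<sigma> t" y] ray_product_upper[of t \<gamma> y] assms(2) by simp
  qed
  then show False by simp
qed

end

locale proper_hyperbolic = four_point_space X K for X :: "'a::metric_space itself" and K +
  assumes proper: "proper_space TYPE('a)" and geodesic: "geodesic_space TYPE('a)"
begin

text \<open>The ray is a limit of geodesics from \<open>p\<close> to points going off along
  \<open>\<sigma>\<close>. In the estimate, 1 comes from \<open>ray_limit\<close>, \<open>?D\<close>
  from moving the base point, and \<open>K\<close> from the four-point inequality.\<close>

lemma ray_from_point:
  fixes \<sigma> :: "real \<Rightarrow> 'a"
  assumes "geodesic_ray \<sigma>"
  obtains \<gamma> where "(\<sigma>, \<gamma>) \<in> asymptotic_rays" "\<gamma> 0 = p"
proof -
  let ?D = "dist (\<sigma> 0) p"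
  have "filterlim (\<lambda>n::nat. - ?D + real n) at_top sequentially"
    by (rule filterlim_tendsto_add_at_top[OF tendsto_const filterlim_real_sequentially])
  then have "filterlim (\<lambda>n. dist p (\<sigma> (real n))) at_top sequentially"
  proof (rule filterlim_at_top_mono, intro always_eventually allI)
    fix n :: nat show "- ?D + real n \<le> dist p (\<sigma> (real n))"
      using dist_geodesic_ray_ge[OF assms, of "real n" p] by (simp add: dist_commute)
  qed
  then obtain \<gamma> where \<gamma>: "geodesic_ray \<gamma>" "\<gamma> 0 = p"
    "\<And>t. 0 \<le> t \<Longrightarrow> \<exists>\<^sub>F n in sequentially. t - 1 \<le> gromov_product p (\<gamma> t) (\<sigma> (real n))"
    using ray_limit[OF proper geodesic, of p "\<lambda>n. \<sigma> (real n)"] by metis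
  have "t - (?D + 1 + K) \<le> gromov_product p (\<gamma> t) (\<sigma> t)" if t: "0 \<le> t" for t
  proof -
    have "\<forall>\<^sub>F n in sequentially. t \<le> real n"
      using filterlim_real_sequentially by (simp add: filterlim_at_top)
    from frequently_ex[OF frequently_eventually_conj[OF \<gamma>(3)[OF t] this]]
    obtain n where n: "t - 1 \<le> gromov_product p (\<gamma> t) (\<sigma> (real n))" "t \<le> real n" by blast
    have "t - ?D \<le> gromov_product p (\<sigma> (real n)) (\<sigma> t)"
      using gromov_product_on_ray[OF assms, of "real n" t] n(2) t
        gromov_product_basepoint[of "\<sigma> 0" "\<sigma> (real n)" "\<sigma> t" p] by simp
    then show ?thesis
      using n(1) four_point[of p "\<gamma> t" "\<sigma> (real n)" "\<sigma> t"] zero_le_dist[of "\<sigma> 0" p] by linarith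
  qed
  then have "(\<gamma>, \<sigma>) \<in> asymptotic_rays" by (rule asymptotic_raysI[OF \<gamma>(1) assms])
  then have "(\<sigma>, \<gamma>) \<in> asymptotic_rays" by (auto simp: asymptotic_rays_def dist_commute)
  with \<gamma>(2) show ?thesis using that by blast
qed

lemma boundary_ray_from_point:
  fixes \<xi> :: "(real \<Rightarrow> 'a) set"
  assumes "\<xi> \<in> gromov_boundary"
  obtains \<gamma> where "geodesic_ray \<gamma>" "\<xi> = vertex \<gamma>" "\<gamma> 0 = p"
proof -
  obtain \<sigma> where \<sigma>: "geodesic_ray \<sigma>" "\<xi> = vertex \<sigma>" by (rule boundary_cases[OF assms])
  obtain \<gamma> where "(\<sigma>, \<gamma>) \<in> asymptotic_rays" "\<gamma> 0 = p" by (rule ray_from_point[OF \<sigma>(1)])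
  then show ?thesis
    using that[of \<gamma>] \<sigma> vertex_eq[of \<sigma> \<gamma>] by (auto simp: asymptotic_rays_def)
qed

section \<open>Neighbourhoods of boundary points\<close>

text \<open>The axiom that turns the sets \<open>gromov_nbhd\<close> into a neighbourhood system.
  Three four-point steps cost \<open>K\<close> each: from \<open>\<tau>\<close> to
  \<open>\<sigma>\<close>, from \<open>\<sigma>\<close> to \<open>\<gamma>\<close> and, for boundary
  points, from \<open>\<rho>\<close> to a ray starting at \<open>p\<close>. The product of
  \<open>\<gamma>\<close> and \<open>\<sigma>\<close> enters after the first, hence
  \<open>2 * K\<close>. The 1 makes the lower limits strict.\<close>

lemma gromov_nbhd_subset:
  fixes \<zeta> \<theta> :: "(real \<Rightarrow> 'a) set"
  assumes \<zeta>: "\<zeta> \<in> gromov_boundary" and \<theta>: "Inr \<theta> \<in> gromov_nbhd p \<zeta> (s + 2 * K + 1)"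
  shows "gromov_nbhd q \<theta> (s + 3 * K + dist q p + 1) \<subseteq> gromov_nbhd p \<zeta> s"
proof
  let ?s = "s + 3 * K + dist q p + 1"
  fix z assume z: "z \<in> gromov_nbhd q \<theta> ?s"
  obtain \<gamma> \<sigma> where \<gamma>: "\<gamma> \<in> \<zeta>" "\<gamma> 0 = p" and \<sigma>: "\<sigma> \<in> \<theta>" "\<sigma> 0 = p" and \<theta>': "\<theta> \<in> gromov_boundary"
    and lim: "ereal (s + 2 * K + 1) \<le> Liminf at_top (\<lambda>t. ereal (gromov_product p (\<gamma> t) (\<sigma> t)))"
    using \<theta> by (auto simp: gromov_nbhd_Inr_iff)
  have "ereal (s + 2 * K) < Liminf at_top (\<lambda>t. ereal (gromov_product p (\<gamma> t) (\<sigma> t)))"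
    by (rule less_le_trans[OF _ lim]) simp
  from less_LiminfD[OF this]
  have \<gamma>\<sigma>: "\<forall>\<^sub>F t in at_top. s + 2 * K < gromov_product p (\<gamma> t) (\<sigma> t)" by simp
  have transfer: "\<forall>\<^sub>F t in at_top. s + K < gromov_product p (\<gamma> t) (w t)"
    if \<tau>: "\<tau> \<in> \<theta>" and lim: "ereal ?s \<le> Liminf at_top (\<lambda>t. ereal (gromov_product q (\<tau> t) (w t)))" for \<tau> w
  proof -
    have "ereal (s + 3 * K + dist q p) < Liminf at_top (\<lambda>t. ereal (gromov_product q (\<tau> t) (w t)))"
      by (rule less_le_trans[OF _ lim]) simp
    from less_LiminfD[OF this]
    have "\<forall>\<^sub>F t in at_top. s + 3 * K + dist q p < gromov_product q (\<tau> t) (w t)" by simp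
    moreover obtain \<tau>' where \<tau>': "\<theta> = vertex \<tau>'" using \<theta>' by (rule boundary_cases)
    have "(\<sigma>, \<tau>) \<in> asymptotic_rays"
      using in_vertexD[of \<sigma> \<tau>'] in_vertexD[of \<tau> \<tau>'] \<sigma>(1) \<tau> \<tau>' unfolding vertex_def by blast
    then have "\<forall>\<^sub>F t in at_top. s + 3 * K < gromov_product p (\<sigma> t) (\<tau> t)"
      using gromov_product_asymptotic_rays[of \<sigma> \<tau> p] by (simp add: filterlim_at_top_dense)
    ultimately show ?thesis using \<gamma>\<sigma>
    proof eventually_elim
      case (elim t)
      then show ?case
        using four_point[of p "\<sigma> t" "\<tau> t" "w t"] four_point[of p "\<gamma> t" "\<sigma> t" "w t"]
          gromov_product_basepoint[of q "\<tau> t" "w t" p] K_nonneg by linarith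
    qed
  qed
  show "z \<in> gromov_nbhd p \<zeta> s"
  proof (cases z)
    case (Inl y)
    obtain \<tau> where "\<tau> \<in> \<theta>" "ereal ?s \<le> Liminf at_top (\<lambda>t. ereal (gromov_product q (\<tau> t) y))"
      using z by (auto simp: gromov_nbhd_def Inl)
    from transfer[OF this] have "\<forall>\<^sub>F t in at_top. ereal s \<le> ereal (gromov_product p (\<gamma> t) y)"
      by eventually_elim (use K_nonneg in simp)
    then have "ereal s \<le> Liminf at_top (\<lambda>t. ereal (gromov_product p (\<gamma> t) y))"
      by (rule Liminf_bounded)
    then show ?thesis using \<gamma> unfolding gromov_nbhd_def Inl by blast
  next
    case (Inr \<kappa>)
    obtain \<tau> \<rho> where \<tau>: "\<tau> \<in> \<theta>" and \<rho>: "\<rho> \<in> \<kappa>" "\<kappa> \<in> gromov_boundary"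
      and lim: "ereal ?s \<le> Liminf at_top (\<lambda>t. ereal (gromov_product q (\<tau> t) (\<rho> t)))"
      using z by (auto simp: gromov_nbhd_Inr_iff Inr)
    obtain \<rho>' where \<rho>': "geodesic_ray \<rho>'" "\<kappa> = vertex \<rho>'" "\<rho>' 0 = p"
      by (rule boundary_ray_from_point[OF \<rho>(2)])
    have asym: "(\<rho>', \<rho>) \<in> asymptotic_rays" using in_vertexD(1) \<rho>(1) \<rho>'(2) by blast
    have "\<forall>\<^sub>F t in at_top. s + K < gromov_product p (\<rho>' t) (\<rho> t)"
      using gromov_product_asymptotic_rays[OF asym, of p] by (simp add: filterlim_at_top_dense)
    with transfer[OF \<tau> lim]
    have "\<forall>\<^sub>F t in at_top. ereal s \<le> ereal (gromov_product p (\<gamma> t) (\<rho>' t))"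
    proof eventually_elim
      case (elim t)
      then show ?case
        using four_point[of p "\<gamma> t" "\<rho> t" "\<rho>' t"] gromov_product_commute[of p "\<rho> t" "\<rho>' t"] by simp
    qed
    then have "ereal s \<le> Liminf at_top (\<lambda>t. ereal (gromov_product p (\<gamma> t) (\<rho>' t)))"
      by (rule Liminf_bounded)
    then show ?thesis
      using \<gamma> \<rho>(2) \<rho>'(3) in_vertex_self[OF \<rho>'(1)] unfolding Inr gromov_nbhd_Inr_iff \<rho>'(2) by blast
  qed
qed

text \<open>\<open>?U\<close> plays the interior of \<open>?A\<close>. Around its boundary points it
  contains a slightly smaller neighbourhood: points of the space belong to it because
  \<open>ray_product\<close> is 1-Lipschitz, boundary points by
  \<open>gromov_nbhd_subset\<close>.\<close>

lemma open_in_gromov_nbhd: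
  fixes \<xi> :: "(real \<Rightarrow> 'a) set"
  assumes \<xi>: "\<xi> \<in> gromov_boundary"
  obtains U where "openin gromov_compactification U" "Inr \<xi> \<in> U"
    "\<And>y. Inl y \<in> U \<Longrightarrow> Inl y \<in> gromov_nbhd p \<xi> r"
proof
  let ?A = "gromov_nbhd p \<xi> r"
  let ?I = "interior {y. Inl y \<in> ?A}"
  let ?B = "{\<zeta> \<in> gromov_boundary. \<forall>q. \<exists>s. gromov_nbhd q \<zeta> s \<subseteq> ?A}"
  let ?U = "Inl ` ?I \<union> Inr ` ?B"
  have vimage: "Inl -` ?U = ?I" by auto
  show "openin gromov_compactification ?U"
    unfolding openin_gromov_compactification vimage
  proof (intro conjI allI impI)
    fix \<zeta> q assume "Inr \<zeta> \<in> ?U"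
    then have \<zeta>: "\<zeta> \<in> gromov_boundary" and "\<exists>s. gromov_nbhd q \<zeta> s \<subseteq> ?A" by auto
    then obtain s where s: "gromov_nbhd q \<zeta> s \<subseteq> ?A" by blast
    have "gromov_nbhd q \<zeta> (s + 2 * K + 1) \<subseteq> ?U"
    proof
      fix z assume z: "z \<in> gromov_nbhd q \<zeta> (s + 2 * K + 1)"
      show "z \<in> ?U"
      proof (cases z)
        case (Inl y)
        obtain \<gamma> where \<gamma>: "\<gamma> \<in> \<zeta>" "\<gamma> 0 = q" "s + 2 * K + 1 \<le> ray_product \<gamma> y"
          using z by (auto simp: Inl gromov_nbhd_Inl_iff[OF \<zeta>])
        have "ball y 1 \<subseteq> {y. Inl y \<in> ?A}"
        proof
          fix y' assume "y' \<in> ball y 1"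
          then have "s \<le> ray_product \<gamma> y'"
            using \<gamma>(3) ray_product_lipschitz[of \<gamma> y y'] K_nonneg by simp
          then show "y' \<in> {y. Inl y \<in> ?A}"
            using \<gamma> s gromov_nbhd_Inl_iff[OF \<zeta>] by blast
        qed
        then have "y \<in> ?I" unfolding mem_interior using zero_less_one by blast
        then show ?thesis using Inl by blast
      next
        case (Inr \<theta>)
        then have "\<theta> \<in> gromov_boundary" using z by (simp add: gromov_nbhd_Inr_iff)
        moreover have "\<exists>s'. gromov_nbhd q' \<theta> s' \<subseteq> ?A" for q'
          using gromov_nbhd_subset[OF \<zeta>, of \<theta> q s] z s Inr by blast
        ultimately show ?thesis using Inr by blast
      qed
    qed
    then show "\<exists>r. gromov_nbhd q \<zeta> r \<subseteq> ?U" by blast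
  qed auto
  obtain \<gamma> where \<gamma>: "geodesic_ray \<gamma>" "\<xi> = vertex \<gamma>" "\<gamma> 0 = p" by (rule boundary_ray_from_point[OF \<xi>])
  have "(\<gamma>, \<gamma>) \<in> asymptotic_rays" using in_vertex_self[OF \<gamma>(1)] by (simp add: vertex_def)
  then have "\<forall>\<^sub>F t in at_top. r + 2 * K + 1 \<le> gromov_product p (\<gamma> t) (\<gamma> t)"
    using gromov_product_asymptotic_rays by (auto simp: filterlim_at_top)
  then have "ereal (r + 2 * K + 1) \<le> Liminf at_top (\<lambda>t. ereal (gromov_product p (\<gamma> t) (\<gamma> t)))"
    by (intro Liminf_bounded) simp
  then have "Inr \<xi> \<in> gromov_nbhd p \<xi> (r + 2 * K + 1)"
    using \<xi> \<gamma> in_vertex_self[OF \<gamma>(1)] unfolding gromov_nbhd_Inr_iff by blast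
  from gromov_nbhd_subset[OF \<xi> this] show "Inr \<xi> \<in> ?U" using \<xi> by blast
  show "Inl y \<in> ?A" if "Inl y \<in> ?U" for y
    using that interior_subset by auto
qed

section \<open>Neighbourhoods of a boundary point as superlevel sets of
  \<open>ray_product\<close>\<close>

lemma openin_vertexD:
  fixes \<gamma> :: "real \<Rightarrow> 'a"
  assumes "geodesic_ray \<gamma>" "openin gromov_compactification U" "Inr (vertex \<gamma>) \<in> U"
  obtains r where "\<And>y. r \<le> ray_product \<gamma> y \<Longrightarrow> Inl y \<in> U"
proof -
  obtain r where r: "gromov_nbhd (\<gamma> 0) (vertex \<gamma>) r \<subseteq> U"
    using assms(2,3) unfolding openin_gromov_compactification by blast
  show ?thesis
  proof (rule that[of r])
    fix y assume "r \<le> ray_product \<gamma> y"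
    then have "Inl y \<in> gromov_nbhd (\<gamma> 0) (vertex \<gamma>) r"
      using in_vertex_self[OF assms(1)] gromov_nbhd_Inl_iff[OF vertex_in_boundary[OF assms(1)]] by blast
    with r show "Inl y \<in> U" by blast
  qed
qed

text \<open>The extra \<open>K\<close> in the level pays for neighbourhoods defined by another ray
  of the class. The equivalences that follow translate filter, limit and closure into superlevel
  sets.\<close>

lemma openin_vertexE:
  fixes \<gamma> :: "real \<Rightarrow> 'a"
  assumes "geodesic_ray \<gamma>"
  obtains U where "openin gromov_compactification U" "Inr (vertex \<gamma>) \<in> U"
    "\<And>y. Inl y \<in> U \<Longrightarrow> r \<le> ray_product \<gamma> y"
proof -
  note bd = vertex_in_boundary[OF assms]
  obtain U where U: "openin gromov_compactification U" "Inr (vertex \<gamma>) \<in> U"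
    "\<And>y. Inl y \<in> U \<Longrightarrow> Inl y \<in> gromov_nbhd (\<gamma> 0) (vertex \<gamma>) (r + K)"
    using open_in_gromov_nbhd[OF bd] by blast
  have "r \<le> ray_product \<gamma> y" if y: "Inl y \<in> U" for y
  proof -
    obtain \<sigma> where "\<sigma> \<in> vertex \<gamma>" "\<sigma> 0 = \<gamma> 0" "r + K \<le> ray_product \<sigma> y"
      using U(3)[OF y] gromov_nbhd_Inl_iff[OF bd] by blast
    then show ?thesis using ray_product_asymptotic[of \<gamma> \<sigma> y] in_vertexD(1)[of \<sigma> \<gamma>] by simp
  qed
  with U(1,2) show ?thesis by (rule that)
qed

lemma eventually_to_vertex_iff:
  fixes \<gamma> :: "real \<Rightarrow> 'a"
  assumes "geodesic_ray \<gamma>"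
  shows "eventually P (filtercomap Inl (nhdsin gromov_compactification (Inr (vertex \<gamma>)))) \<longleftrightarrow>
    (\<exists>r. \<forall>y. r \<le> ray_product \<gamma> y \<longrightarrow> P y)"
proof
  have top: "Inr (vertex \<gamma>) \<in> topspace gromov_compactification"
    using vertex_in_boundary[OF assms] by (simp add: topspace_gromov_compactification)
  {
    assume "eventually P (filtercomap Inl (nhdsin gromov_compactification (Inr (vertex \<gamma>))))"
    then obtain U where U: "openin gromov_compactification U" "Inr (vertex \<gamma>) \<in> U" "\<And>y. Inl y \<in> U \<Longrightarrow> P y"
      using top unfolding eventually_filtercomap eventually_nhdsin by blast
    from openin_vertexD[OF assms U(1,2)] show "\<exists>r. \<forall>y. r \<le> ray_product \<gamma> y \<longrightarrow> P y"
      using U(3) by metis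
  }
  assume "\<exists>r. \<forall>y. r \<le> ray_product \<gamma> y \<longrightarrow> P y"
  then obtain r where r: "\<And>y. r \<le> ray_product \<gamma> y \<Longrightarrow> P y" by blast
  obtain U where U: "openin gromov_compactification U" "Inr (vertex \<gamma>) \<in> U"
    "\<And>y. Inl y \<in> U \<Longrightarrow> r \<le> ray_product \<gamma> y"
    using openin_vertexE[OF assms] by metis
  then have "eventually (\<lambda>z. z \<in> U) (nhdsin gromov_compactification (Inr (vertex \<gamma>)))"
    by (auto simp: eventually_nhdsin)
  then show "eventually P (filtercomap Inl (nhdsin gromov_compactification (Inr (vertex \<gamma>))))"
    unfolding eventually_filtercomap using U(3) r by blast
qed

lemma tends_to_vertex_iff:
  fixes \<gamma> :: "real \<Rightarrow> 'a"
  assumes "geodesic_ray \<gamma>"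
  shows "tends_to_boundary u (vertex \<gamma>) \<longleftrightarrow> filterlim (\<lambda>n. ray_product \<gamma> (u n)) at_top sequentially"
proof
  assume lim: "tends_to_boundary u (vertex \<gamma>)"
  show "filterlim (\<lambda>n. ray_product \<gamma> (u n)) at_top sequentially"
    unfolding filterlim_at_top
  proof
    fix r
    obtain U where U: "openin gromov_compactification U" "Inr (vertex \<gamma>) \<in> U"
      "\<And>y. Inl y \<in> U \<Longrightarrow> r \<le> ray_product \<gamma> y"
      using openin_vertexE[OF assms] by metis
    then have "\<forall>\<^sub>F n in sequentially. Inl (u n) \<in> U"
      using lim unfolding tends_to_boundary_def limitin_def by blast
    then show "\<forall>\<^sub>F n in sequentially. r \<le> ray_product \<gamma> (u n)" by eventually_elim (rule U(3))
  qed
next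
  assume lim: "filterlim (\<lambda>n. ray_product \<gamma> (u n)) at_top sequentially"
  show "tends_to_boundary u (vertex \<gamma>)"
    unfolding tends_to_boundary_def limitin_def
  proof (intro conjI allI impI)
    show "Inr (vertex \<gamma>) \<in> topspace gromov_compactification"
      using vertex_in_boundary[OF assms] by (simp add: topspace_gromov_compactification)
    fix U assume U: "openin gromov_compactification U \<and> Inr (vertex \<gamma>) \<in> U"
    obtain r where r: "\<And>y. r \<le> ray_product \<gamma> y \<Longrightarrow> Inl y \<in> U"
      using openin_vertexD[OF assms] U by metis
    have "\<forall>\<^sub>F n in sequentially. r \<le> ray_product \<gamma> (u n)" using lim by (simp add: filterlim_at_top)
    then show "\<forall>\<^sub>F n in sequentially. Inl (u n) \<in> U" by eventually_elim (rule r)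
  qed
qed

lemma vertex_in_closure_iff:
  fixes \<gamma> :: "real \<Rightarrow> 'a"
  assumes "geodesic_ray \<gamma>"
  shows "Inr (vertex \<gamma>) \<in> gromov_compactification closure_of (Inl ` S) \<longleftrightarrow>
    (\<forall>r. \<exists>y\<in>S. r \<le> ray_product \<gamma> y)"
proof
  assume cl: "Inr (vertex \<gamma>) \<in> gromov_compactification closure_of (Inl ` S)"
  show "\<forall>r. \<exists>y\<in>S. r \<le> ray_product \<gamma> y"
  proof
    fix r
    obtain U where U: "openin gromov_compactification U" "Inr (vertex \<gamma>) \<in> U"
      "\<And>y. Inl y \<in> U \<Longrightarrow> r \<le> ray_product \<gamma> y"
      using openin_vertexE[OF assms] by metis
    then show "\<exists>y\<in>S. r \<le> ray_product \<gamma> y" using cl unfolding in_closure_of by blast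
  qed
next
  assume S: "\<forall>r. \<exists>y\<in>S. r \<le> ray_product \<gamma> y"
  show "Inr (vertex \<gamma>) \<in> gromov_compactification closure_of (Inl ` S)"
    unfolding in_closure_of
  proof (intro conjI allI impI)
    show "Inr (vertex \<gamma>) \<in> topspace gromov_compactification"
      using vertex_in_boundary[OF assms] by (simp add: topspace_gromov_compactification)
    fix U assume U: "Inr (vertex \<gamma>) \<in> U \<and> openin gromov_compactification U"
    obtain r where "\<And>y. r \<le> ray_product \<gamma> y \<Longrightarrow> Inl y \<in> U"
      using openin_vertexD[OF assms] U by metis
    then show "\<exists>y. y \<in> Inl ` S \<and> y \<in> U" using S by blast
  qed
qed

text \<open>A point of the sequence that is deep for both rays, inserted between
  \<open>\<gamma> t\<close> and \<open>\<sigma> t\<close>, makes their product almost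
  \<open>t\<close>.\<close>

lemma tends_to_boundary_unique:
  fixes \<gamma> \<sigma> :: "real \<Rightarrow> 'a"
  assumes "geodesic_ray \<gamma>" "geodesic_ray \<sigma>" "\<gamma> 0 = \<sigma> 0"
    and "tends_to_boundary u (vertex \<gamma>)" "tends_to_boundary u (vertex \<sigma>)"
  shows "vertex \<gamma> = vertex \<sigma>"
proof -
  have "t - 2 * K \<le> gromov_product (\<gamma> 0) (\<gamma> t) (\<sigma> t)" if t: "0 \<le> t" for t
  proof -
    have "\<forall>\<^sub>F n in sequentially. t \<le> ray_product \<gamma> (u n)" "\<forall>\<^sub>F n in sequentially. t \<le> ray_product \<sigma> (u n)"
      using assms tends_to_vertex_iff by (auto simp: filterlim_at_top)
    then have "\<forall>\<^sub>F n in sequentially. t \<le> ray_product \<gamma> (u n) \<and> t \<le> ray_product \<sigma> (u n)"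
      by (rule eventually_conj)
    then obtain n where n: "t \<le> ray_product \<gamma> (u n)" "t \<le> ray_product \<sigma> (u n)"
      by (auto simp: eventually_sequentially)
    have "t - K \<le> gromov_product (\<gamma> 0) (\<gamma> t) (u n)" "t - K \<le> gromov_product (\<gamma> 0) (u n) (\<sigma> t)"
      using gromov_product_ge_ray_product[OF assms(1), of "\<gamma> t" "u n"] n ray_product_on_ray[OF assms(1) t]
        gromov_product_ge_ray_product[OF assms(2), of "u n" "\<sigma> t"] ray_product_on_ray[OF assms(2) t] assms(3)
      by simp_all
    then show ?thesis using four_point[of "\<gamma> 0" "\<gamma> t" "u n" "\<sigma> t"] by simp
  qed
  then have "(\<gamma>, \<sigma>) \<in> asymptotic_rays" by (rule asymptotic_raysI[OF assms(1,2)])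
  then show ?thesis by (rule vertex_eq)
qed

end

section \<open>Non-expanding maps along a ray\<close>

definition nonexpanding :: "('a::metric_space \<Rightarrow> 'a) \<Rightarrow> bool" where
  "nonexpanding g \<longleftrightarrow> (\<forall>x y. dist (g x) (g y) \<le> dist x y)"

lemma nonexpandingD: "nonexpanding g \<Longrightarrow> dist (g x) (g y) \<le> dist x y"
  by (simp add: nonexpanding_def)

lemma nonexpanding_funpow: "nonexpanding f \<Longrightarrow> nonexpanding (f ^^ n)"
  by (induction n) (auto simp: nonexpanding_def, meson order_trans)

text \<open>How far \<open>g\<close> moves \<open>\<gamma> t\<close> towards the base point \<open>\<gamma> 0\<close>. Its supremum over \<open>t\<close> agrees with
  \<open>log_dilation g (\<gamma> 0) (vertex \<gamma>)\<close> up to a constant depending on the space only.\<close>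

definition retreat :: "(real \<Rightarrow> 'a::metric_space) \<Rightarrow> ('a \<Rightarrow> 'a) \<Rightarrow> real \<Rightarrow> real" where
  "retreat \<gamma> g t = t - dist (g (\<gamma> t)) (\<gamma> 0)"

definition total_retreat :: "(real \<Rightarrow> 'a::metric_space) \<Rightarrow> ('a \<Rightarrow> 'a) \<Rightarrow> real" where
  "total_retreat \<gamma> g = (SUP t\<in>{0..}. retreat \<gamma> g t)"

definition coarsely_fixes_ray :: "('a::metric_space \<Rightarrow> 'a) \<Rightarrow> (real \<Rightarrow> 'a) \<Rightarrow> bool" where
  "coarsely_fixes_ray g \<gamma> \<longleftrightarrow> (\<exists>M. \<forall>t\<ge>0. dist (g (\<gamma> t)) (\<gamma> t) \<le> M)"

text \<open>Advancing by \<open>t - s\<close> moves the image by at most that much. Hence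
  \<open>total_retreat\<close> can be read off far out on the ray.\<close>

lemma retreat_mono:
  assumes "geodesic_ray \<gamma>" "nonexpanding g" "0 \<le> s" "s \<le> t"
  shows "retreat \<gamma> g s \<le> retreat \<gamma> g t"
  using dist_triangle[of "g (\<gamma> t)" "\<gamma> 0" "g (\<gamma> s)"] nonexpandingD[OF assms(2), of "\<gamma> t" "\<gamma> s"]
    geodesic_rayD[OF assms(1), of t s] assms(3,4) by (simp add: retreat_def)

text \<open>Together with \<open>boundary_regular_fixed_point_iff\<close> this passes boundary
  regular fixed points to all iterates.\<close>

lemma coarsely_fixes_ray_funpow:
  assumes "nonexpanding f" "coarsely_fixes_ray f \<gamma>"
  shows "coarsely_fixes_ray (f ^^ n) \<gamma>"
proof (induction n)
  case 0
  show ?case by (auto simp: coarsely_fixes_ray_def)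
next
  case (Suc n)
  then obtain M where M: "\<And>t. 0 \<le> t \<Longrightarrow> dist ((f ^^ n) (\<gamma> t)) (\<gamma> t) \<le> M"
    by (auto simp: coarsely_fixes_ray_def)
  obtain N where N: "\<And>t. 0 \<le> t \<Longrightarrow> dist (f (\<gamma> t)) (\<gamma> t) \<le> N"
    using assms(2) by (auto simp: coarsely_fixes_ray_def)
  have "dist ((f ^^ Suc n) (\<gamma> t)) (\<gamma> t) \<le> M + N" if "0 \<le> t" for t
    using dist_triangle[of "f ((f ^^ n) (\<gamma> t))" "\<gamma> t" "f (\<gamma> t)"] M[OF that] N[OF that]
      nonexpandingD[OF assms(1), of "(f ^^ n) (\<gamma> t)" "\<gamma> t"] by simp
  then show ?case by (auto simp: coarsely_fixes_ray_def)
qed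

lemma retreat_le:
  assumes "geodesic_ray \<gamma>" "dist (g (\<gamma> t)) (\<gamma> t) \<le> M" "0 \<le> t"
  shows "retreat \<gamma> g t \<le> M"
  using dist_triangle[of "\<gamma> t" "\<gamma> 0" "g (\<gamma> t)"] assms dist_geodesic_ray_start[OF assms(1,3)]
  by (simp add: retreat_def dist_commute)

lemma
  assumes "geodesic_ray \<gamma>" "coarsely_fixes_ray g \<gamma>"
  shows bdd_above_retreat: "bdd_above (retreat \<gamma> g ` {0..})"
    and retreat_le_total: "0 \<le> t \<Longrightarrow> retreat \<gamma> g t \<le> total_retreat \<gamma> g"
proof -
  obtain M where "\<And>t. 0 \<le> t \<Longrightarrow> dist (g (\<gamma> t)) (\<gamma> t) \<le> M"
    using assms(2) by (auto simp: coarsely_fixes_ray_def)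
  then show bdd: "bdd_above (retreat \<gamma> g ` {0..})"
    unfolding bdd_above_def by (intro exI[of _ M]) (auto intro: retreat_le[OF assms(1)])
  show "0 \<le> t \<Longrightarrow> retreat \<gamma> g t \<le> total_retreat \<gamma> g"
    unfolding total_retreat_def by (intro cSUP_upper bdd) simp
qed

lemma total_retreat_least:
  "(\<And>t. 0 \<le> t \<Longrightarrow> retreat \<gamma> g t \<le> c) \<Longrightarrow> total_retreat \<gamma> g \<le> c"
  unfolding total_retreat_def by (intro cSUP_least) auto

lemma tendsto_retreat:
  assumes "geodesic_ray \<gamma>" "nonexpanding g" "coarsely_fixes_ray g \<gamma>"
  shows "(retreat \<gamma> g \<longlongrightarrow> total_retreat \<gamma> g) at_top"
proof (rule order_tendstoI)
  fix a assume "a < total_retreat \<gamma> g"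
  then obtain s where s: "0 \<le> s" "a < retreat \<gamma> g s"
    unfolding total_retreat_def using bdd_above_retreat[OF assms(1,3)] by (auto simp: less_cSUP_iff)
  show "\<forall>\<^sub>F t in at_top. a < retreat \<gamma> g t"
    using eventually_ge_at_top[of s]
    by eventually_elim (use s retreat_mono[OF assms(1,2) s(1)] less_le_trans in blast)
next
  fix a assume a: "total_retreat \<gamma> g < a"
  show "\<forall>\<^sub>F t in at_top. retreat \<gamma> g t < a"
    using eventually_ge_at_top[of "0::real"]
    by eventually_elim (use a retreat_le_total[OF assms(1,3)] le_less_trans in blast)
qed

lemma coarsely_fixes_rayI:
  assumes ray: "geodesic_ray \<gamma>" and g: "nonexpanding g"
    and D: "\<And>t. 0 \<le> t \<Longrightarrow> t - D \<le> gromov_product (\<gamma> 0) (g (\<gamma> t)) (\<gamma> t)"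
  shows "coarsely_fixes_ray g \<gamma>"
  unfolding coarsely_fixes_ray_def
proof (intro exI allI impI)
  fix t :: real assume t: "0 \<le> t"
  have "dist (g (\<gamma> t)) (\<gamma> 0) \<le> t + dist (g (\<gamma> 0)) (\<gamma> 0)"
    using dist_triangle[of "g (\<gamma> t)" "\<gamma> 0" "g (\<gamma> 0)"] nonexpandingD[OF g, of "\<gamma> t" "\<gamma> 0"]
      dist_geodesic_ray_start[OF ray t] by simp
  then show "dist (g (\<gamma> t)) (\<gamma> t) \<le> dist (g (\<gamma> 0)) (\<gamma> 0) + 2 * D"
    using D[OF t] dist_eq_gromov_product[of "g (\<gamma> t)" "\<gamma> t" "\<gamma> 0"] dist_geodesic_ray_start[OF ray t]
    by simp
qed

lemma filterlim_ray_product_image: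
  assumes "geodesic_ray \<gamma>" "coarsely_fixes_ray g \<gamma>"
  shows "filterlim (\<lambda>t. ray_product \<gamma> (g (\<gamma> t))) at_top at_top"
proof -
  obtain M where M: "\<And>t. 0 \<le> t \<Longrightarrow> dist (g (\<gamma> t)) (\<gamma> t) \<le> M"
    using assms(2) by (auto simp: coarsely_fixes_ray_def)
  have "filterlim (\<lambda>t. - M + t) at_top at_top"
    by (rule filterlim_tendsto_add_at_top[OF tendsto_const filterlim_ident])
  moreover have "\<forall>\<^sub>F t in at_top. - M + t \<le> ray_product \<gamma> (g (\<gamma> t))"
    using eventually_ge_at_top[of "0::real"]
  proof eventually_elim
    case (elim t)
    then show ?case
      using M[of t] ray_product_lipschitz[of \<gamma> "\<gamma> t" "g (\<gamma> t)"] ray_product_on_ray[OF assms(1), of t]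
      by (simp add: dist_commute)
  qed
  ultimately show ?thesis by (rule filterlim_at_top_mono)
qed

text \<open>Stability of additivity in the sense of Hyers and Ulam. Comparing
  \<open>a (m * n)\<close> with \<open>m\<close> copies of \<open>a n\<close> and with
  \<open>n\<close> copies of \<open>a m\<close> gives
  \<open>(a m - C) / m \<le> (a n + C) / n\<close> for all positive \<open>m\<close> and
  \<open>n\<close>; the infimum of the right-hand sides separates the two families.\<close>

lemma quasi_additive_sequence:
  fixes a :: "nat \<Rightarrow> real"
  assumes quasi: "\<And>m n. \<bar>a (m + n) - a m - a n\<bar> \<le> C"
  obtains l where "\<And>n. \<bar>a n - real n * l\<bar> \<le> C"
proof -
  have mult: "\<bar>a (Suc m * n) - real (Suc m) * a n\<bar> \<le> real m * C" for m n
  proof (induction m)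
    case (Suc m)
    have "\<bar>a (n + Suc m * n) - a n - a (Suc m * n)\<bar> \<le> C" by (rule quasi)
    with Suc.IH show ?case by (simp add: algebra_simps abs_le_iff)
  qed simp
  \<comment> \<open>\<open>Suc m\<close> copies need only \<open>m\<close> splittings. For
    \<open>m = 0\<close> the bound would be 0, while \<open>a 0\<close> is only known up to
    \<open>C\<close>.\<close>
  have mult': "\<bar>a (m * n) - real m * a n\<bar> \<le> real m * C" if "m \<ge> 1" for m n
  proof -
    have "C \<ge> 0" using quasi[of 0 0] by linarith
    then show ?thesis using mult[of "m - 1" n] that by (auto simp: algebra_simps of_nat_diff)
  qed
  define A where "A = (\<lambda>n. (a n + C) / real n) ` {1..}"
  have le: "(a m - C) / real m \<le> x" if m: "m \<ge> 1" and x: "x \<in> A" for m x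
  proof -
    obtain n where n: "n \<ge> 1" "x = (a n + C) / real n" using x by (auto simp: A_def)
    have "real n * a m - real n * C \<le> a (n * m)" "a (m * n) \<le> real m * a n + real m * C"
      using mult'[OF n(1), of m] mult'[OF m, of n] by linarith+
    then have "real n * (a m - C) \<le> real m * (a n + C)" by (simp add: algebra_simps)
    then show ?thesis unfolding n(2) using n(1) m by (simp add: field_simps)
  qed
  have "\<bar>a n - real n * Inf A\<bar> \<le> C" for n
  proof (cases "n = 0")
    case True
    then show ?thesis using quasi[of 0 0] by simp
  next
    case False
    then have n: "n \<ge> 1" by simp
    have "(a n - C) / real n \<le> Inf A" using le[OF n] by (intro cInf_greatest) (auto simp: A_def)
    moreover have "Inf A \<le> (a n + C) / real n"
      using le[of 1] n by (intro cInf_lower) (auto simp: A_def bdd_below_def)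
    ultimately show ?thesis using n by (simp add: field_simps abs_le_iff)
  qed
  then show ?thesis by (rule that)
qed

lemma tendsto_divide_real:
  assumes "\<And>n. \<bar>x n - real n * l\<bar> \<le> C"
  shows "(\<lambda>n. x n / real n) \<longlonglongrightarrow> l"
proof -
  have "(\<lambda>n. C / real n) \<longlonglongrightarrow> 0" by (rule lim_const_over_n)
  moreover have "\<forall>\<^sub>F n in sequentially. norm (x n / real n - l) \<le> C / real n"
    using eventually_gt_at_top[of 0]
  proof eventually_elim
    case (elim n)
    then have "x n / real n - l = (x n - real n * l) / real n" by (simp add: field_simps)
    then show ?case using assms[of n] elim by (simp add: divide_right_mono)
  qed
  ultimately have "(\<lambda>n. x n / real n - l) \<longlonglongrightarrow> 0" by (rule Lim_null_comparison[rotated])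
  then show ?thesis by (simp add: LIM_zero_iff)
qed

section \<open>Comparison of \<open>log_dilation\<close> with retreats along a ray\<close>

context proper_hyperbolic
begin

text \<open>A point \<open>z\<close> deep enough lies almost behind \<open>\<gamma> t\<close>: its
  distance to \<open>\<gamma> 0\<close> is at least \<open>t + dist (\<gamma> t) z\<close> up to
  \<open>2 * K\<close>. A non-expanding \<open>g\<close> therefore draws \<open>z\<close> back at
  least as far as \<open>\<gamma> t\<close>, up to this error. The points \<open>z\<close> are
  arbitrary, so that points of the limit retract can be used as well.\<close>

lemma retreat_le_of_approach:
  fixes \<gamma> :: "real \<Rightarrow> 'a"
  assumes ray: "geodesic_ray \<gamma>" and g: "nonexpanding g"
    and z: "\<And>r. \<exists>z. r \<le> ray_product \<gamma> z \<and> dist z (\<gamma> 0) - dist (g z) (\<gamma> 0) \<le> L"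
    and t: "0 \<le> t"
  shows "retreat \<gamma> g t \<le> L + 2 * K"
proof -
  obtain z where z: "t \<le> ray_product \<gamma> z" "dist z (\<gamma> 0) - dist (g z) (\<gamma> 0) \<le> L"
    using z by blast
  have "t - K \<le> gromov_product (\<gamma> 0) (\<gamma> t) z"
    using gromov_product_ge_ray_product[OF ray, of "\<gamma> t" z] ray_product_on_ray[OF ray t] z(1) by simp
  then have "dist (\<gamma> t) z \<le> dist z (\<gamma> 0) - t + 2 * K"
    using dist_eq_gromov_product[of "\<gamma> t" z "\<gamma> 0"] dist_geodesic_ray_start[OF ray t] by simp
  moreover have "dist (g z) (\<gamma> 0) \<le> dist (\<gamma> t) z + dist (g (\<gamma> t)) (\<gamma> 0)"
    using dist_triangle[of "g z" "\<gamma> 0" "g (\<gamma> t)"] nonexpandingD[OF g, of z "\<gamma> t"]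
    by (simp add: dist_commute)
  ultimately show ?thesis using z(2) by (simp add: retreat_def)
qed

lemma retreat_le_log_dilation:
  fixes \<gamma> :: "real \<Rightarrow> 'a"
  assumes ray: "geodesic_ray \<gamma>" and g: "nonexpanding g"
    and L: "log_dilation g (\<gamma> 0) (vertex \<gamma>) < ereal L" and t: "0 \<le> t"
  shows "retreat \<gamma> g t \<le> L + 2 * K"
proof (rule retreat_le_of_approach[OF ray g _ t], rule ccontr)
  fix r assume "\<not> (\<exists>z. r \<le> ray_product \<gamma> z \<and> dist z (\<gamma> 0) - dist (g z) (\<gamma> 0) \<le> L)"
  then have "\<forall>z. r \<le> ray_product \<gamma> z \<longrightarrow> ereal L \<le> ereal (dist z (\<gamma> 0) - dist (g z) (\<gamma> 0))"
    by (metis ereal_less_eq(3) linear)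
  then have "ereal L \<le> log_dilation g (\<gamma> 0) (vertex \<gamma>)"
    unfolding log_dilation_def eventually_to_vertex_iff[OF ray, symmetric]
    by (intro Liminf_bounded) (use eventually_to_vertex_iff[OF ray] in blast)
  with L show False by simp
qed

lemma log_dilation_le:
  fixes \<gamma> :: "real \<Rightarrow> 'a"
  assumes ray: "geodesic_ray \<gamma>" and L: "\<And>t. 0 \<le> t \<Longrightarrow> retreat \<gamma> g t \<le> L"
  shows "log_dilation g (\<gamma> 0) (vertex \<gamma>) \<le> ereal L"
proof (rule ccontr)
  assume "\<not> ?thesis"
  then have "ereal L < log_dilation g (\<gamma> 0) (vertex \<gamma>)" by simp
  from less_LiminfD[OF this[unfolded log_dilation_def]]
  obtain r where r: "\<And>y. r \<le> ray_product \<gamma> y \<Longrightarrow> ereal L < ereal (dist y (\<gamma> 0) - dist (g y) (\<gamma> 0))"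
    unfolding eventually_to_vertex_iff[OF ray] by blast
  have "0 \<le> max 0 r" by simp
  from ray_product_on_ray[OF ray this] dist_geodesic_ray_start[OF ray this] L[OF this]
  show False using r[of "\<gamma> (max 0 r)"] by (simp add: retreat_def)
qed

lemma log_dilation_basepoint:
  fixes \<gamma> :: "real \<Rightarrow> 'a"
  assumes ray: "geodesic_ray \<gamma>"
  shows "log_dilation g q (vertex \<gamma>) \<le> log_dilation g p (vertex \<gamma>) + ereal (2 * dist p q)"
proof -
  let ?F = "filtercomap Inl (nhdsin gromov_compactification (Inr (vertex \<gamma>)))"
  have "\<not> eventually (\<lambda>_. False) ?F"
  proof
    assume "eventually (\<lambda>_. False) ?F"
    then obtain r where "\<And>y. \<not> r \<le> ray_product \<gamma> y"
      unfolding eventually_to_vertex_iff[OF ray] by blast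
    then show False using ray_product_on_ray[OF ray, of "max 0 r"] by (metis max.cobounded1 max.cobounded2)
  qed
  then have "?F \<noteq> bot" by auto
  then have "log_dilation g p (vertex \<gamma>) + ereal (2 * dist p q) =
      Liminf ?F (\<lambda>z. ereal (dist z p - dist (g z) p) + ereal (2 * dist p q))"
    unfolding log_dilation_def by (subst Liminf_add_ereal_right) auto
  moreover have "log_dilation g q (vertex \<gamma>) \<le> \<dots>"
    unfolding log_dilation_def
  proof (intro Liminf_mono always_eventually allI)
    fix z
    show "ereal (dist z q - dist (g z) q) \<le> ereal (dist z p - dist (g z) p) + ereal (2 * dist p q)"
      using dist_triangle[of z q p] dist_triangle[of "g z" p q] by (simp add: dist_commute)
  qed
  ultimately show ?thesis by simp
qed

text \<open>The geodesic limit gives depth without a rate. A far \<open>\<gamma> n\<close> hands it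
  on to \<open>\<gamma> t\<close>: both images are far from \<open>\<gamma> 0\<close> by the bound
  on retreats and at most \<open>n - t\<close> apart, so their product is at least
  \<open>t - L\<close>.\<close>

lemma ray_product_image_ge:
  fixes \<gamma> :: "real \<Rightarrow> 'a"
  assumes ray: "geodesic_ray \<gamma>" and g: "nonexpanding g"
    and lim: "filterlim (\<lambda>n. ray_product \<gamma> (g (\<gamma> (real n)))) at_top sequentially"
    and L: "\<And>t. 0 \<le> t \<Longrightarrow> retreat \<gamma> g t \<le> L" and t: "0 \<le> t"
  shows "t - L - K \<le> ray_product \<gamma> (g (\<gamma> t))"
proof -
  have "\<forall>\<^sub>F n in sequentially. t - L \<le> ray_product \<gamma> (g (\<gamma> (real n)))"
    using lim by (simp add: filterlim_at_top)
  moreover have "\<forall>\<^sub>F n in sequentially. t \<le> real n"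
    using filterlim_real_sequentially by (simp add: filterlim_at_top)
  ultimately have "\<forall>\<^sub>F n in sequentially. t - L \<le> ray_product \<gamma> (g (\<gamma> (real n))) \<and> t \<le> real n"
    by (rule eventually_conj)
  then obtain n where n: "t - L \<le> ray_product \<gamma> (g (\<gamma> (real n)))" "t \<le> real n"
    by (auto simp: eventually_sequentially)
  have "t - L \<le> dist (g (\<gamma> t)) (\<gamma> 0)" "real n - L \<le> dist (g (\<gamma> (real n))) (\<gamma> 0)"
    using L[OF t] L[of "real n"] by (simp_all add: retreat_def)
  moreover have "dist (g (\<gamma> t)) (g (\<gamma> (real n))) \<le> real n - t"
    using nonexpandingD[OF g, of "\<gamma> t" "\<gamma> (real n)"] geodesic_rayD[OF ray t, of "real n"] n(2) by simp
  ultimately have "t - L \<le> gromov_product (\<gamma> 0) (g (\<gamma> t)) (g (\<gamma> (real n)))"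
    by (simp add: gromov_product_def field_simps)
  then show ?thesis using ray_product_ge[of \<gamma> "g (\<gamma> t)" "g (\<gamma> (real n))"] n(1) by simp
qed

lemma ray_product_image_ge_total:
  fixes \<gamma> :: "real \<Rightarrow> 'a"
  assumes ray: "geodesic_ray \<gamma>" and g: "nonexpanding g" "coarsely_fixes_ray g \<gamma>" and t: "0 \<le> t"
  shows "t - total_retreat \<gamma> g - K \<le> ray_product \<gamma> (g (\<gamma> t))"
  using filterlim_compose[OF filterlim_ray_product_image[OF ray g(2)] filterlim_real_sequentially]
    retreat_le_total[OF ray g(2)] t by (intro ray_product_image_ge[OF ray g(1)])

text \<open>Forward, finite dilation bounds the retreats, and the geodesic limit keeps the images
  from escaping in another direction. Backward, points of a geodesic region are within bounded
  distance of the ray, hence moved by a bounded amount.\<close>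

lemma boundary_regular_fixed_point_iff:
  fixes \<gamma> :: "real \<Rightarrow> 'a"
  assumes ray: "geodesic_ray \<gamma>" and g: "nonexpanding g"
  shows "boundary_regular_fixed_point g (vertex \<gamma>) \<longleftrightarrow> coarsely_fixes_ray g \<gamma>"
proof
  assume brfp: "boundary_regular_fixed_point g (vertex \<gamma>)"
  then have "log_dilation g (\<gamma> 0) (vertex \<gamma>) < \<infinity>" by (simp add: boundary_regular_fixed_point_def)
  then obtain N :: nat where N: "log_dilation g (\<gamma> 0) (vertex \<gamma>) < ereal (real N)"
    using less_PInf_Ex_of_nat by auto
  let ?L = "real N + 2 * K"
  have L: "retreat \<gamma> g t \<le> ?L" if "0 \<le> t" for t by (rule retreat_le_log_dilation[OF ray g N that])
  have "tends_to_boundary (\<lambda>n. \<gamma> (real n)) (vertex \<gamma>)"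
    unfolding tends_to_vertex_iff[OF ray]
    by (simp add: ray_product_on_ray[OF ray] filterlim_real_sequentially)
  moreover have "\<gamma> (real n) \<in> geodesic_region \<gamma> 1" for n by (simp add: geodesic_region_def)
  ultimately have "tends_to_boundary (\<lambda>n. g (\<gamma> (real n))) (vertex \<gamma>)"
    using brfp ray unfolding boundary_regular_fixed_point_def has_geodesic_limit_def
    by (elim conjE allE[of _ \<gamma>] allE[of _ "1::real"] allE[of _ "\<lambda>n. \<gamma> (real n)"]) simp
  then have "filterlim (\<lambda>n. ray_product \<gamma> (g (\<gamma> (real n)))) at_top sequentially"
    by (simp add: tends_to_vertex_iff[OF ray])
  from ray_product_image_ge[OF ray g this L]
  have ge: "t - ?L - K \<le> ray_product \<gamma> (g (\<gamma> t))" if "0 \<le> t" for t using that by simp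
  show "coarsely_fixes_ray g \<gamma>"
  proof (rule coarsely_fixes_rayI[OF ray g])
    fix t :: real assume t: "0 \<le> t"
    show "t - (?L + 2 * K) \<le> gromov_product (\<gamma> 0) (g (\<gamma> t)) (\<gamma> t)"
      using gromov_product_ge_ray_product[OF ray, of "g (\<gamma> t)" "\<gamma> t"] ge[OF t] ray_product_on_ray[OF ray t]
        K_nonneg by (simp add: min_def split: if_splits)
  qed
next
  assume fix_ray: "coarsely_fixes_ray g \<gamma>"
  obtain M where M: "\<And>t. 0 \<le> t \<Longrightarrow> dist (g (\<gamma> t)) (\<gamma> t) \<le> M"
    using fix_ray by (auto simp: coarsely_fixes_ray_def)
  show "boundary_regular_fixed_point g (vertex \<gamma>)"
    unfolding boundary_regular_fixed_point_def
  proof (intro conjI allI)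
    show "vertex \<gamma> \<in> gromov_boundary" by (rule vertex_in_boundary[OF ray])
    fix q
    have "log_dilation g q (vertex \<gamma>) \<le> log_dilation g (\<gamma> 0) (vertex \<gamma>) + ereal (2 * dist (\<gamma> 0) q)"
      by (rule log_dilation_basepoint[OF ray])
    also have "\<dots> \<le> ereal M + ereal (2 * dist (\<gamma> 0) q)"
      using M by (intro add_right_mono log_dilation_le[OF ray] retreat_le[OF ray])
    also have "\<dots> < \<infinity>" by simp
    finally show "log_dilation g q (vertex \<gamma>) < \<infinity>" .
  next
    show "has_geodesic_limit g (vertex \<gamma>) (vertex \<gamma>)"
      unfolding has_geodesic_limit_def
    proof (intro allI impI, elim conjE)
      fix \<sigma> R u
      assume \<sigma>: "geodesic_ray \<sigma>" "vertex \<sigma> = vertex \<gamma>" and R: "0 < R"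
        and u: "\<forall>n. u n \<in> geodesic_region \<sigma> R" "tends_to_boundary u (vertex \<gamma>)"
      have "(\<sigma>, \<gamma>) \<in> asymptotic_rays"
        using in_vertexD(1)[of \<gamma> \<sigma>] in_vertex_self[OF ray] \<sigma>(2) by simp
      then obtain C where C: "\<And>t. 0 \<le> t \<Longrightarrow> dist (\<sigma> t) (\<gamma> t) \<le> C"
        using asymptotic_raysD by blast
      have disp: "dist (u n) (g (u n)) \<le> 2 * (R + C) + M" for n
      proof -
        have "infdist (u n) (\<sigma> ` {0..}) < R" using u(1) by (simp add: geodesic_region_def)
        then obtain t where t: "0 \<le> t" "dist (u n) (\<sigma> t) < R"
          by (rule infdist_lessD) auto
        have "dist (u n) (\<gamma> t) \<le> R + C"
          using dist_triangle[of "u n" "\<gamma> t" "\<sigma> t"] t C[OF t(1)] by simp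
        moreover have "dist (u n) (g (u n)) \<le> dist (u n) (\<gamma> t) + dist (\<gamma> t) (g (\<gamma> t)) + dist (g (\<gamma> t)) (g (u n))"
          using dist_triangle[of "u n" "g (u n)" "\<gamma> t"] dist_triangle[of "\<gamma> t" "g (u n)" "g (\<gamma> t)"] by simp
        ultimately show ?thesis
          using M[OF t(1)] nonexpandingD[OF g, of "u n" "\<gamma> t"] by (simp add: dist_commute)
      qed
      have "filterlim (\<lambda>n. - (2 * (R + C) + M) + ray_product \<gamma> (u n)) at_top sequentially"
        using u(2) by (intro filterlim_tendsto_add_at_top[OF tendsto_const])
          (simp add: tends_to_vertex_iff[OF ray])
      then have "filterlim (\<lambda>n. ray_product \<gamma> (g (u n))) at_top sequentially"
      proof (rule filterlim_at_top_mono, intro always_eventually allI)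
        fix n show "- (2 * (R + C) + M) + ray_product \<gamma> (u n) \<le> ray_product \<gamma> (g (u n))"
          using disp[of n] ray_product_lipschitz[of \<gamma> "u n" "g (u n)"] by simp
      qed
      then show "tends_to_boundary (\<lambda>n. g (u n)) (vertex \<gamma>)" by (simp add: tends_to_vertex_iff[OF ray])
    qed
  qed
qed

text \<open>Far out on the ray, \<open>h (\<gamma> t)\<close> is uniformly close to \<open>\<gamma> s\<close> with \<open>s\<close> its distance to \<open>\<gamma> 0\<close>, so
  retreats of composed maps add up to a constant depending on the space only.\<close>

lemma total_retreat_comp:
  fixes \<gamma> :: "real \<Rightarrow> 'a"
  assumes ray: "geodesic_ray \<gamma>"
    and g: "nonexpanding g" "coarsely_fixes_ray g \<gamma>"
    and h: "nonexpanding h" "coarsely_fixes_ray h \<gamma>"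
    and gh: "coarsely_fixes_ray (g \<circ> h) \<gamma>"
  shows "\<bar>total_retreat \<gamma> (g \<circ> h) - total_retreat \<gamma> g - total_retreat \<gamma> h\<bar> \<le> 4 * K + 5"
proof -
  have gh1: "nonexpanding (g \<circ> h)"
    using g(1) h(1) unfolding nonexpanding_def comp_def by (meson order_trans)
  let ?s = "\<lambda>t. dist (h (\<gamma> t)) (\<gamma> 0)"
  let ?near = "\<lambda>g t. \<bar>retreat \<gamma> g t - total_retreat \<gamma> g\<bar> < 1"
  have near: "\<forall>\<^sub>F t in at_top. ?near g t" if "nonexpanding g" "coarsely_fixes_ray g \<gamma>" for g
    using tendstoD[OF tendsto_retreat[OF ray that] zero_less_one] by (simp add: dist_real_def)
  have "filterlim (\<lambda>t. - total_retreat \<gamma> h + t) at_top at_top"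
    by (rule filterlim_tendsto_add_at_top[OF tendsto_const filterlim_ident])
  then have s: "filterlim ?s at_top at_top"
  proof (rule filterlim_at_top_mono)
    show "\<forall>\<^sub>F t in at_top. - total_retreat \<gamma> h + t \<le> ?s t"
      using eventually_ge_at_top[of "0::real"]
      by eventually_elim (use retreat_le_total[OF ray h(2)] in \<open>fastforce simp: retreat_def\<close>)
  qed
  have "\<forall>\<^sub>F t::real in at_top. False" if "\<not> ?thesis"
    using near[OF h] near[OF gh1 gh] eventually_compose_filterlim[OF near[OF g] s]
      eventually_ge_at_top[of "0::real"]
  proof eventually_elim
    \<comment> \<open>The claim is free of \<open>t\<close>, so one large \<open>t\<close> decides
      it. There \<open>h (\<gamma> t)\<close> is within \<open>2 + 4 * K\<close> of
      \<open>\<gamma> (?s t)\<close>, and the three errors \<open>?near\<close> contribute at most 1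
      each.\<close>
    case (elim t)
    let ?x = "h (\<gamma> t)"
    have "t - total_retreat \<gamma> h - K \<le> ray_product \<gamma> ?x"
      by (rule ray_product_image_ge_total[OF ray h elim(4)])
    then have "?s t - 1 - 2 * K \<le> gromov_product (\<gamma> 0) ?x (\<gamma> (?s t))"
      using elim(1) gromov_product_ge_ray_product[OF ray, of ?x "\<gamma> (?s t)"]
        ray_product_on_ray[OF ray, of "?s t"] K_nonneg
      by (simp add: retreat_def min_def split: if_splits)
    then have "dist ?x (\<gamma> (?s t)) \<le> 2 + 4 * K"
      using dist_eq_gromov_product[of ?x "\<gamma> (?s t)" "\<gamma> 0"] dist_geodesic_ray_start[OF ray, of "?s t"]
      by simp
    then have "dist (g ?x) (g (\<gamma> (?s t))) \<le> 2 + 4 * K" using nonexpandingD[OF g(1)] order_trans by blast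
    then have "\<bar>dist (g ?x) (\<gamma> 0) - dist (g (\<gamma> (?s t))) (\<gamma> 0)\<bar> \<le> 2 + 4 * K"
      using dist_triangle[of "g ?x" "\<gamma> 0" "g (\<gamma> (?s t))"] dist_triangle[of "g (\<gamma> (?s t))" "\<gamma> 0" "g ?x"]
      by (simp add: dist_commute abs_le_iff)
    with elim(1,2,3) that show False by (simp add: retreat_def)
  qed
  then show ?thesis by auto
qed

text \<open>The comparison at \<open>\<gamma> 0\<close> costs \<open>2 * K\<close>, the change of
  base point the rest. Finiteness comes out on the way, so \<open>real_of_ereal\<close> is
  harmless.\<close>

lemma log_dilation_total_retreat:
  fixes \<gamma> :: "real \<Rightarrow> 'a"
  assumes ray: "geodesic_ray \<gamma>" and g: "nonexpanding g" "coarsely_fixes_ray g \<gamma>"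
  shows "\<bar>real_of_ereal (log_dilation g q (vertex \<gamma>)) - total_retreat \<gamma> g\<bar> \<le> 2 * K + 2 * dist (\<gamma> 0) q"
proof -
  let ?p = "\<gamma> 0" and ?a = "total_retreat \<gamma> g"
  let ?A = "\<lambda>q. log_dilation g q (vertex \<gamma>)"
  have le: "?A ?p \<le> ereal ?a" using retreat_le_total[OF ray g(2)] by (intro log_dilation_le[OF ray])
  have ge: "ereal (?a - 2 * K) \<le> ?A ?p"
  proof (rule ccontr)
    assume "\<not> ?thesis"
    then have "?A ?p < ereal (?a - 2 * K)" by (rule not_le_imp_less)
    from ereal_dense2[OF this]
    obtain L where L: "?A ?p < ereal L" "ereal L < ereal (?a - 2 * K)" by (elim exE conjE) (rule that)
    have "?a \<le> L + 2 * K" by (intro total_retreat_least retreat_le_log_dilation[OF ray g(1) L(1)])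
    with L(2) show False by simp
  qed
  have "?A q \<le> ?A ?p + ereal (2 * dist ?p q)" "?A ?p \<le> ?A q + ereal (2 * dist q ?p)"
    by (rule log_dilation_basepoint[OF ray])+
  with le ge show ?thesis
    by (cases "?A q"; cases "?A ?p") (auto simp: dist_commute abs_le_iff)
qed

text \<open>Base point and comparison with \<open>total_retreat\<close> contribute bounded errors,
  removed by the division by \<open>n\<close>: the limit \<open>l\<close> exists and is independent
  of \<open>q\<close>.\<close>

lemma stable_dilation_eq:
  fixes \<gamma> :: "real \<Rightarrow> 'a"
  assumes ray: "geodesic_ray \<gamma>" and f: "nonexpanding f" "coarsely_fixes_ray f \<gamma>"
  obtains l C where "\<And>q. stable_dilation f q (vertex \<gamma>) = exp l"
    "\<And>n. \<bar>total_retreat \<gamma> (f ^^ n) - real n * l\<bar> \<le> C"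
proof -
  note fn = nonexpanding_funpow[OF f(1)] coarsely_fixes_ray_funpow[OF f]
  have "\<bar>total_retreat \<gamma> (f ^^ (m + n)) - total_retreat \<gamma> (f ^^ m) - total_retreat \<gamma> (f ^^ n)\<bar> \<le> 4 * K + 5" for m n
    using total_retreat_comp[OF ray fn(1,2) fn(1,2), of m n] fn(2)[of "m + n"] by (simp add: funpow_add)
  from quasi_additive_sequence[of "\<lambda>n. total_retreat \<gamma> (f ^^ n)", OF this]
  obtain l where l: "\<And>n. \<bar>total_retreat \<gamma> (f ^^ n) - real n * l\<bar> \<le> 4 * K + 5" by blast
  have "stable_dilation f q (vertex \<gamma>) = exp l" for q
  proof -
    have "(\<lambda>n. real_of_ereal (log_dilation (f ^^ n) q (vertex \<gamma>)) / real n) \<longlonglongrightarrow> l"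
    proof (rule tendsto_divide_real)
      fix n
      show "\<bar>real_of_ereal (log_dilation (f ^^ n) q (vertex \<gamma>)) - real n * l\<bar>
          \<le> (2 * K + 2 * dist (\<gamma> 0) q) + (4 * K + 5)"
        using l[of n] log_dilation_total_retreat[OF ray fn, of n q] by linarith
    qed
    then show ?thesis by (simp add: stable_dilation_def limI)
  qed
  then show ?thesis using l by (rule that)
qed

end

section \<open>Escaping orbits\<close>

text \<open>Some iterate carries one visit of the orbit of \<open>x\<close> near \<open>y\<close> to
  a later one; being non-expanding, it moves \<open>y\<close> little.\<close>

lemma limit_retract_recurrent:
  assumes f: "nonexpanding f" and y: "y \<in> limit_retract f" and e: "0 < e"
  obtains m where "dist ((f ^^ (n + m)) y) y < e"
proof -
  obtain x r where r: "strict_mono (r :: nat \<Rightarrow> nat)" "(\<lambda>k. (f ^^ r k) x) \<longlonglongrightarrow> y"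
    using y by (auto simp: limit_retract_def)
  obtain k where k: "\<And>i. i \<ge> k \<Longrightarrow> dist ((f ^^ r i) x) y < e / 2"
    using metric_LIMSEQ_D[OF r(2), of "e / 2"] e by auto
  \<comment> \<open>As \<open>i \<le> r i\<close>, this visit comes at least \<open>n\<close> steps
    after the one at time \<open>r k\<close>.\<close>
  define i where "i = k + r k + n"
  have i: "i \<ge> k" "r k + n \<le> r i" using strict_mono_imp_increasing[OF r(1), of i] by (auto simp: i_def)
  define m where "m = r i - r k - n"
  have eq: "(f ^^ (n + m)) ((f ^^ r k) x) = (f ^^ r i) x"
    using i(2) by (simp add: m_def flip: funpow_add comp_apply[of "f ^^ _"])
  have "dist ((f ^^ (n + m)) y) y \<le> dist ((f ^^ (n + m)) y) ((f ^^ r i) x) + dist ((f ^^ r i) x) y"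
    by (rule dist_triangle)
  also have "dist ((f ^^ (n + m)) y) ((f ^^ r i) x) \<le> dist y ((f ^^ r k) x)"
    unfolding eq[symmetric] by (rule nonexpandingD[OF nonexpanding_funpow[OF f]])
  also have "dist y ((f ^^ r k) x) + dist ((f ^^ r i) x) y < e"
    using k[of k] k[OF i(1)] by (simp add: dist_commute)
  finally show ?thesis using that by simp
qed

text \<open>Calka's argument: \<open>f\<close> is isometric on the orbit of a recurrent point, so by compactness the
  return times to the unit ball can be followed backwards with bounded gaps.\<close>

lemma bounded_recurrent_orbit:
  fixes f :: "'a::metric_space \<Rightarrow> 'a"
  assumes proper: "proper_space TYPE('a)" and f: "nonexpanding f"
    and rec: "\<And>n e. 0 < e \<Longrightarrow> \<exists>m. dist ((f ^^ (n + m)) y) y < e"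
  obtains B where "\<And>n. dist ((f ^^ n) y) y \<le> B"
proof -
  define Y where "Y n = (f ^^ n) y" for n
  have add: "Y (m + n) = (f ^^ m) (Y n)" for m n by (simp add: Y_def funpow_add)
  have le: "dist (Y (k + n)) (Y (k + m)) \<le> dist (Y n) (Y m)" for k n m
    unfolding add by (rule nonexpandingD[OF nonexpanding_funpow[OF f]])
  \<comment> \<open>By recurrence some iterate \<open>k + j\<close> moves \<open>y\<close>, hence
    each point of its orbit, by less than \<open>e / 2\<close>. So \<open>j\<close> further steps
    after the first \<open>k\<close> almost restore the original distance.\<close>
  have iso: "dist (Y (k + n)) (Y (k + m)) = dist (Y n) (Y m)" for k n m
  proof (rule antisym[OF le], rule field_le_epsilon)
    fix e :: real assume "0 < e"
    then obtain j where j: "dist (Y (k + j)) (Y 0) < e / 2"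
      using rec[of "e / 2" k] by (auto simp: Y_def)
    have "dist (Y (i + (k + j))) (Y i) < e / 2" for i using le[of i "k + j" 0] j by simp
    from this[of n] this[of m] show "dist (Y n) (Y m) \<le> dist (Y (k + n)) (Y (k + m)) + e"
      using le[of j "k + n" "k + m"] dist_triangle[of "Y n" "Y m" "Y (n + (k + j))"]
        dist_triangle[of "Y (n + (k + j))" "Y m" "Y (m + (k + j))"]
      by (simp add: dist_commute ac_simps)
  qed
  have "compact (cball y 1)" using proper by (simp add: proper_space_def)
  then have "\<exists>F. finite F \<and> cball y 1 \<subseteq> (\<Union>x\<in>F. ball x (1/2))"
    unfolding compact_eq_totally_bounded by simp
  then obtain F where F: "finite F" "cball y 1 \<subseteq> (\<Union>x\<in>F. ball x (1/2))" by blast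
  define a where "a c = (SOME k. 1 \<le> k \<and> dist c (Y k) < 1/2)" for c
  have a: "1 \<le> a c \<and> dist c (Y (a c)) < 1/2" if "1 \<le> k" "dist c (Y k) < 1/2" for c k
    unfolding a_def by (rule someI[of _ k]) (use that in simp)
  \<comment> \<open>A bound for one positive visiting time to each ball of the net that is visited
    at all; \<open>insert 1\<close> keeps the set nonempty.\<close>
  define N where "N = Max (insert 1 (a ` F))"
  have net: "\<exists>k. 1 \<le> k \<and> k \<le> N \<and> dist (Y n) (Y k) \<le> 1" if n: "1 \<le> n" "dist (Y n) y \<le> 1" for n
  proof -
    obtain c where c: "c \<in> F" "dist c (Y n) < 1/2" using F(2) n(2) by (auto simp: dist_commute)
    have "a c \<ge> 1" "dist c (Y (a c)) < 1/2" using a[OF n(1) c(2)] by auto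
    moreover have "a c \<le> N" unfolding N_def using F(1) c(1) by (intro Max_ge) auto
    moreover have "dist (Y n) (Y (a c)) \<le> dist c (Y n) + dist c (Y (a c))" by (rule dist_triangle3)
    ultimately show ?thesis using c(2) by (intro exI[of _ "a c"]) auto
  qed
  have return: "\<exists>j\<le>m. dist (Y j) y \<le> 1 \<and> m \<le> j + N" if "dist (Y n) y \<le> 1" "m \<le> n" for n m
    using that
  proof (induction n rule: less_induct)
    case (less n)
    show ?case
    proof (cases "m = n")
      case True
      then show ?thesis using less.prems(1) by (intro exI[of _ m]) simp
    next
      case False
      then have n: "1 \<le> n" "m < n" using less.prems(2) by auto
      from net[OF n(1) less.prems(1)]
      obtain k where k: "1 \<le> k" "k \<le> N" "dist (Y n) (Y k) \<le> 1" by (elim exE conjE) (rule that)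
      show ?thesis
      proof (cases "k \<le> n")
        case True
        \<comment> \<open>Cancelling \<open>k\<close> by isometry shows that \<open>n - k\<close> is
          again a visit to the unit ball, at most \<open>N\<close> steps earlier;
          \<open>1 \<le> k\<close> makes the induction decrease.\<close>
        have D: "dist (Y (n - k)) y \<le> 1"
          using iso[of k "n - k" 0] k(3) True by (simp add: Y_def)
        show ?thesis
        proof (cases "m \<le> n - k")
          case True
          show ?thesis by (rule less.IH[OF _ D True]) (use k(1) n(1) in simp)
        next
          case False
          then show ?thesis using D k(2) n(2) by (intro exI[of _ "n - k"]) auto
        qed
      next
        case False
        then show ?thesis using n(2) k(2) by (intro exI[of _ 0]) (simp add: Y_def)
      qed
    qed
  qed
  have steps: "dist (Y (j + i)) (Y j) \<le> real i * dist (Y 1) (Y 0)" for i j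
  proof (induction i)
    case (Suc i)
    have "dist (Y (j + Suc i)) (Y j) \<le> dist (Y (j + Suc i)) (Y (j + i)) + dist (Y (j + i)) (Y j)"
      by (rule dist_triangle)
    also have "dist (Y (j + Suc i)) (Y (j + i)) = dist (Y 1) (Y 0)" using iso[of "j + i" 1 0] by simp
    finally show ?case using Suc.IH by (simp add: algebra_simps)
  qed simp
  have "dist (Y m) y \<le> 1 + real N * dist (Y 1) (Y 0)" for m
  proof -
    obtain i where "dist (Y (m + i)) y < 1" using rec[of 1 m] by (auto simp: Y_def)
    then obtain j where j: "j \<le> m" "dist (Y j) y \<le> 1" "m \<le> j + N" using return[of "m + i" m] by auto
    have "dist (Y m) (Y j) \<le> real (m - j) * dist (Y 1) (Y 0)" using steps[of j "m - j"] j(1) by simp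
    also have "\<dots> \<le> real N * dist (Y 1) (Y 0)" using j by (intro mult_right_mono) auto
    finally show ?thesis using j(2) dist_triangle[of "Y m" y "Y j"] by simp
  qed
  then show ?thesis using that unfolding Y_def by blast
qed

lemma orbit_bounded_iff:
  assumes "nonexpanding f"
  shows "elliptic_map f \<longleftrightarrow> (\<exists>B. \<forall>n. dist ((f ^^ n) p) p \<le> B)"
proof
  assume "elliptic_map f"
  then obtain x B where B: "\<And>n. dist x ((f ^^ n) x) \<le> B"
    unfolding elliptic_map_def by (metis bounded_any_center rangeI)
  have "dist ((f ^^ n) p) p \<le> B + 2 * dist p x" for n
    using nonexpandingD[OF nonexpanding_funpow[OF assms], of n p x] B[of n]
      dist_triangle[of "(f ^^ n) p" p "(f ^^ n) x"] dist_triangle[of "(f ^^ n) x" p x]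
    by (simp add: dist_commute)
  then show "\<exists>B. \<forall>n. dist ((f ^^ n) p) p \<le> B" by blast
next
  assume "\<exists>B. \<forall>n. dist ((f ^^ n) p) p \<le> B"
  then show "elliptic_map f"
    unfolding elliptic_map_def bounded_any_center[where a = p] by (auto simp: dist_commute)
qed

lemma cball_sequence_limit_retract:
  fixes f :: "'a::metric_space \<Rightarrow> 'a"
  assumes proper: "proper_space TYPE('a)" and r: "strict_mono (r :: nat \<Rightarrow> nat)"
    and R: "\<And>k. dist ((f ^^ r k) x) p \<le> R"
  obtains y s where "strict_mono s" "(\<lambda>k. (f ^^ r (s k)) x) \<longlonglongrightarrow> y" "y \<in> limit_retract f"
proof -
  have "compact (cball p R)" using proper by (simp add: proper_space_def)
  then have "seq_compact (cball p R)" by (rule compact_imp_seq_compact)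
  moreover have "\<forall>k. (f ^^ r k) x \<in> cball p R" using R by (simp add: dist_commute)
  ultimately obtain y s where "y \<in> cball p R" and s: "strict_mono s" "((\<lambda>k. (f ^^ r k) x) \<circ> s) \<longlonglongrightarrow> y"
    by (rule seq_compactE[where f = "\<lambda>k. (f ^^ r k) x"])
  then have lim: "(\<lambda>k. (f ^^ (r \<circ> s) k) x) \<longlonglongrightarrow> y" by (simp add: comp_def)
  have "y \<in> limit_retract f"
    unfolding limit_retract_def using strict_mono_o[OF r s(1)] lim by blast
  with s(1) lim show ?thesis using that by simp
qed

text \<open>If the orbit came back to a ball infinitely often, compactness would give a point of the
  limit retract; this point is recurrent and so has a bounded orbit.\<close>

lemma nonelliptic_orbit_escapes:
  fixes f :: "'a::metric_space \<Rightarrow> 'a"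
  assumes proper: "proper_space TYPE('a)" and f: "nonexpanding f" and ne: "\<not> elliptic_map f"
  shows "filterlim (\<lambda>n. dist p ((f ^^ n) p)) at_top sequentially"
proof (rule ccontr)
  assume "\<not> ?thesis"
  then obtain R where "\<not> (\<forall>\<^sub>F n in sequentially. R \<le> dist p ((f ^^ n) p))"
    unfolding filterlim_at_top by blast
  then have "infinite {n. dist p ((f ^^ n) p) < R}"
    by (simp add: not_eventually not_le frequently_cofinite flip: cofinite_eq_sequentially)
  then obtain r :: "nat \<Rightarrow> nat" where r: "strict_mono r" "\<And>k. dist p ((f ^^ r k) p) < R"
    using infinite_enumerate by blast
  have R: "dist ((f ^^ r k) p) p \<le> R" for k using r(2)[of k] by (simp add: dist_commute less_imp_le)
  obtain y where y: "y \<in> limit_retract f"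
    using cball_sequence_limit_retract[OF proper r(1) R] by metis
  have "\<exists>m. dist ((f ^^ (n + m)) y) y < e" if "0 < e" for n e
    using limit_retract_recurrent[OF f y that] by metis
  from bounded_recurrent_orbit[OF proper f this]
  have "\<exists>B. \<forall>n. dist ((f ^^ n) y) y \<le> B" by metis
  with ne show False using orbit_bounded_iff[OF f] by blast
qed

text \<open>Take the least \<open>n \<ge> N\<close> at which \<open>a\<close> reaches its maximum
  over \<open>{..N}\<close>; by minimality the times in between stay below that maximum.\<close>

lemma record_time:
  fixes a :: "nat \<Rightarrow> real"
  assumes "filterlim a at_top sequentially"
  obtains n where "N \<le> n" "\<And>m. m \<le> n \<Longrightarrow> a m \<le> a n"
proof -
  let ?M = "Max (a ` {..N})"
  have "\<forall>\<^sub>F n in sequentially. ?M \<le> a n \<and> N \<le> n"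
    using assms unfolding filterlim_at_top by (intro eventually_conj eventually_ge_at_top) blast
  then have ex: "\<exists>n. ?M \<le> a n \<and> N \<le> n" by (auto simp: eventually_sequentially)
  define n where "n = (LEAST n. ?M \<le> a n \<and> N \<le> n)"
  have n: "?M \<le> a n" "N \<le> n" using LeastI_ex[OF ex] by (auto simp: n_def)
  have "a m \<le> a n" if m: "m \<le> n" for m
  proof (cases "m \<le> N \<or> m = n")
    case True
    have "a m \<le> ?M" if "m \<le> N" using that by (intro Max_ge) auto
    then show ?thesis using n True by auto
  next
    case False
    then have "m < n" using m by simp
    then have "\<not> (?M \<le> a m \<and> N \<le> m)" unfolding n_def by (rule not_less_Least)
    with False n(1) show ?thesis by linarith
  qed
  with n(2) show ?thesis by (rule that)
qed

section \<open>Convergence of escaping orbits\<close>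

context proper_hyperbolic
begin

lemma denjoy_wolff_pointI:
  fixes \<gamma> :: "real \<Rightarrow> 'a"
  assumes ray: "geodesic_ray \<gamma>" and f: "nonexpanding f"
    and lim: "filterlim (\<lambda>n. ray_product \<gamma> ((f ^^ n) p)) at_top sequentially"
  shows "denjoy_wolff_point f (vertex \<gamma>)"
  unfolding denjoy_wolff_point_def
proof (intro conjI allI)
  show "vertex \<gamma> \<in> gromov_boundary" by (rule vertex_in_boundary[OF ray])
  fix x
  have "filterlim (\<lambda>n. - dist p x + ray_product \<gamma> ((f ^^ n) p)) at_top sequentially"
    by (rule filterlim_tendsto_add_at_top[OF tendsto_const lim])
  then show "tends_to_boundary (\<lambda>n. (f ^^ n) x) (vertex \<gamma>)"
    unfolding tends_to_vertex_iff[OF ray]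
  proof (rule filterlim_at_top_mono, intro always_eventually allI)
    fix n show "- dist p x + ray_product \<gamma> ((f ^^ n) p) \<le> ray_product \<gamma> ((f ^^ n) x)"
      using ray_product_lipschitz[of \<gamma> "(f ^^ n) p" "(f ^^ n) x"]
        nonexpandingD[OF nonexpanding_funpow[OF f], of n p x] by simp
  qed
qed

text \<open>Karlsson's argument: at a time \<open>n\<close> at which the distance from the base point is maximal so far,
  the Gromov product of \<open>f\<^sup>n p\<close> with each earlier \<open>f\<^sup>m p\<close> is at least \<open>dist p (f\<^sup>m p) / 2\<close>.\<close>

lemma escaping_orbit_converges:
  fixes f :: "'a \<Rightarrow> 'a"
  assumes f: "nonexpanding f" and esc: "filterlim (\<lambda>n. dist p ((f ^^ n) p)) at_top sequentially"
  obtains \<gamma> where "geodesic_ray \<gamma>" "\<gamma> 0 = p" "denjoy_wolff_point f (vertex \<gamma>)"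
    "\<And>m t. 0 \<le> t \<Longrightarrow> retreat \<gamma> (f ^^ m) t \<le> 2 * K" "coarsely_fixes_ray f \<gamma>"
proof -
  define x where "x n = (f ^^ n) p" for n
  define a where "a n = dist p (x n)" for n
  have add: "x (m + n) = (f ^^ m) (x n)" for m n by (simp add: x_def funpow_add)
  have a_lim: "filterlim a at_top sequentially" using esc by (simp add: a_def[abs_def] x_def)
  have "\<forall>N. \<exists>n. N \<le> n \<and> (\<forall>m\<le>n. a m \<le> a n)" using record_time[OF a_lim] by metis
  then obtain r where r: "\<And>k. k \<le> r k" "\<And>k m. m \<le> r k \<Longrightarrow> a m \<le> a (r k)" by metis
  have "filterlim (\<lambda>k. dist p (x (r k))) at_top sequentially"
    using a_lim by (rule filterlim_at_top_mono) (use r in \<open>auto simp: a_def[symmetric]\<close>)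
  then obtain \<gamma> where ray: "geodesic_ray \<gamma>" and start: "\<gamma> 0 = p"
    and freq: "\<And>t. 0 \<le> t \<Longrightarrow> \<exists>\<^sub>F k in sequentially. t - 1 \<le> gromov_product p (\<gamma> t) (x (r k))"
    by (rule ray_limit[OF proper geodesic]) blast
  have half: "a m / 2 \<le> gromov_product p (x (r k)) (x m)" if "m \<le> r k" for m k
  proof -
    have "dist (x (m + (r k - m))) (x (m + 0)) \<le> dist (x (r k - m)) (x 0)"
      unfolding add by (rule nonexpandingD[OF nonexpanding_funpow[OF f]])
    then have "dist (x (r k)) (x m) \<le> a (r k - m)" using that by (simp add: a_def x_def dist_commute)
    also have "\<dots> \<le> a (r k)" by (rule r(2)) simp
    finally show ?thesis by (simp add: gromov_product_def a_def dist_commute field_simps)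
  qed
  have ge: "a m / 2 - K \<le> ray_product \<gamma> (x m)" for m
  proof -
    \<comment> \<open>The summand 1 makes up for the loss in \<open>ray_limit\<close>.\<close>
    let ?t = "a m / 2 + 1"
    have t: "0 \<le> ?t" by (simp add: a_def)
    from frequently_ex[OF frequently_eventually_conj[OF freq[OF t] eventually_ge_at_top[of m]]]
    obtain k where k: "?t - 1 \<le> gromov_product p (\<gamma> ?t) (x (r k))" "m \<le> k" by blast
    have "m \<le> r k" using k(2) r(1) order_trans by blast
    from k(1) half[OF this] show ?thesis
      using four_point[of p "\<gamma> ?t" "x (r k)" "x m"] ray_product_upper[OF t, of \<gamma> "x m"] start by simp
  qed
  have "filterlim (\<lambda>n. a n * (1 / 2)) at_top sequentially"
    by (rule filterlim_at_top_mult_tendsto_pos[OF tendsto_const _ a_lim]) simp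
  from filterlim_tendsto_add_at_top[OF tendsto_const[of "- K"] this]
  have lim: "filterlim (\<lambda>n. ray_product \<gamma> (x n)) at_top sequentially"
    by (rule filterlim_at_top_mono) (use ge in \<open>simp add: algebra_simps\<close>)
  have approach: "t - K \<le> gromov_product p (\<gamma> t) (x n)" if "0 \<le> t" "t \<le> ray_product \<gamma> (x n)" for t n
    using gromov_product_ge_ray_product[OF ray, of "\<gamma> t" "x n"] ray_product_on_ray[OF ray] that start
    by simp
  have step: "\<exists>n. a n \<le> a (n + m) \<and> t \<le> ray_product \<gamma> (x (n + m)) \<and>
      dist ((f ^^ m) (\<gamma> t)) (x (n + m)) \<le> a n - t + 2 * K" if t: "0 \<le> t" for m t
  proof -
    obtain N where N: "\<And>n. N \<le> n \<Longrightarrow> t \<le> ray_product \<gamma> (x n)"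
      using lim unfolding filterlim_at_top eventually_sequentially by blast
    \<comment> \<open>The time \<open>n + m\<close> is a record, so the \<open>m\<close> steps from
      \<open>x n\<close> bring it no closer to \<open>p\<close>. As \<open>x n\<close> lies almost
      behind \<open>\<gamma> t\<close>, this bounds the retreat of \<open>\<gamma> t\<close> under
      \<open>f ^^ m\<close> uniformly in \<open>m\<close>.\<close>
    define n where "n = r (N + m) - m"
    have n: "N \<le> n" "n + m = r (N + m)" using r(1)[of "N + m"] by (auto simp: n_def)
    have "dist (\<gamma> t) (x n) \<le> a n - t + 2 * K"
      using approach[OF t N[OF n(1)]] dist_eq_gromov_product[of "\<gamma> t" "x n" p]
        dist_geodesic_ray_start[OF ray t] start by (simp add: a_def dist_commute)
    moreover have "dist ((f ^^ m) (\<gamma> t)) ((f ^^ m) (x n)) \<le> dist (\<gamma> t) (x n)"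
      by (rule nonexpandingD[OF nonexpanding_funpow[OF f]])
    moreover have "a n \<le> a (n + m)" unfolding n(2) by (rule r(2)) (use n(2) in simp)
    moreover have "t \<le> ray_product \<gamma> (x (n + m))" using n(1) by (intro N) simp
    ultimately show ?thesis using add[of m n] by (intro exI[of _ n]) (simp add: add.commute)
  qed
  have retreat: "retreat \<gamma> (f ^^ m) t \<le> 2 * K" if t: "0 \<le> t" for m t
  proof -
    obtain n where "a n \<le> a (n + m)" "dist ((f ^^ m) (\<gamma> t)) (x (n + m)) \<le> a n - t + 2 * K"
      using step[OF t] by blast
    then show ?thesis
      using dist_triangle[of p "x (n + m)" "(f ^^ m) (\<gamma> t)"]
      by (simp add: retreat_def start a_def dist_commute)
  qed
  have fixed: "coarsely_fixes_ray f \<gamma>"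
  proof (rule coarsely_fixes_rayI[OF ray f])
    fix t :: real assume t: "0 \<le> t"
    obtain n where n: "a n \<le> a (n + 1)" "t \<le> ray_product \<gamma> (x (n + 1))"
      "dist (f (\<gamma> t)) (x (n + 1)) \<le> a n - t + 2 * K"
      using step[OF t, of 1] by auto
    have "t - 2 * K \<le> dist (f (\<gamma> t)) p" using retreat[OF t, of 1] by (simp add: retreat_def start)
    then have "t - 2 * K \<le> gromov_product p (f (\<gamma> t)) (x (n + 1))"
      using n(1,3) by (simp add: gromov_product_def a_def dist_commute field_simps)
    then show "t - 3 * K \<le> gromov_product (\<gamma> 0) (f (\<gamma> t)) (\<gamma> t)"
      unfolding start
      using approach[OF t n(2)] four_point[of p "f (\<gamma> t)" "x (n + 1)" "\<gamma> t"] K_nonneg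
        gromov_product_commute[of p "\<gamma> t" "x (n + 1)"] by linarith
  qed
  have "denjoy_wolff_point f (vertex \<gamma>)"
    using lim unfolding x_def by (rule denjoy_wolff_pointI[OF ray f])
  with ray start show ?thesis using retreat fixed by (rule that)
qed

section \<open>Orbits and the stable dilation\<close>

text \<open>A coarse form of Julia's lemma.\<close>

lemma ray_product_image_julia:
  fixes \<gamma> :: "real \<Rightarrow> 'a"
  assumes ray: "geodesic_ray \<gamma>" and g: "nonexpanding g" "coarsely_fixes_ray g \<gamma>"
  shows "(dist (g x) (\<gamma> 0) - total_retreat \<gamma> g - dist x (\<gamma> 0)) / 2 - K \<le> ray_product \<gamma> (g x)"
proof -
  let ?c = "(dist (g x) (\<gamma> 0) - total_retreat \<gamma> g - dist x (\<gamma> 0)) / 2"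
  have "\<forall>\<^sub>F t in at_top. ?c \<le> ray_product \<gamma> (g (\<gamma> t))"
    using filterlim_ray_product_image[OF ray g(2)] unfolding filterlim_at_top by blast
  moreover have "\<forall>\<^sub>F t::real in at_top. 0 \<le> t" by (rule eventually_ge_at_top)
  ultimately have "\<forall>\<^sub>F t in at_top. ?c \<le> ray_product \<gamma> (g (\<gamma> t)) \<and> 0 \<le> t" by (rule eventually_conj)
  then obtain t where t: "?c \<le> ray_product \<gamma> (g (\<gamma> t))" "0 \<le> t"
    by (auto simp: eventually_at_top_linorder)
  have "dist (g x) (g (\<gamma> t)) \<le> dist x (\<gamma> 0) + t"
    using nonexpandingD[OF g(1), of x "\<gamma> t"] dist_triangle[of x "\<gamma> t" "\<gamma> 0"]
      dist_geodesic_ray_start[OF ray t(2)] by (simp add: dist_commute)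
  \<comment> \<open>The image of \<open>\<gamma> t\<close> is at least
    \<open>t - total_retreat \<gamma> g\<close> away from \<open>\<gamma> 0\<close>, so
    \<open>t\<close> cancels.\<close>
  then have "?c \<le> gromov_product (\<gamma> 0) (g x) (g (\<gamma> t))"
    using retreat_le_total[OF ray g(2) t(2)] by (simp add: gromov_product_def retreat_def field_simps)
  then show ?thesis using ray_product_ge[of \<gamma> "g x" "g (\<gamma> t)"] t(1) by linarith
qed

text \<open>With \<open>l < 0\<close> the retreats alone drive the estimate of Julia's lemma to
  infinity, the distance term being nonnegative. As \<open>ray_product\<close> is at most the
  distance to \<open>\<gamma> 0\<close>, the orbit is then unbounded.\<close>

lemma stable_dilation_less_one:
  fixes \<gamma> :: "real \<Rightarrow> 'a"
  assumes ray: "geodesic_ray \<gamma>" and f: "nonexpanding f" "coarsely_fixes_ray f \<gamma>"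
    and less: "stable_dilation f p (vertex \<gamma>) < 1"
  shows "hyperbolic_map f" "denjoy_wolff_point f (vertex \<gamma>)"
proof -
  obtain l C where l: "\<And>q. stable_dilation f q (vertex \<gamma>) = exp l"
    "\<And>n. \<bar>total_retreat \<gamma> (f ^^ n) - real n * l\<bar> \<le> C"
    by (rule stable_dilation_eq[OF ray f]) blast
  have neg: "0 < - l / 2" using less l(1) by simp
  let ?x = "\<lambda>n. (f ^^ n) (\<gamma> 0)"
  have "filterlim (\<lambda>n. - l / 2 * real n) at_top sequentially"
    by (rule filterlim_tendsto_pos_mult_at_top[OF tendsto_const neg filterlim_real_sequentially])
  from filterlim_tendsto_add_at_top[OF tendsto_const[of "- C / 2 - K"] this]
  have lim: "filterlim (\<lambda>n. ray_product \<gamma> (?x n)) at_top sequentially"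
  proof (rule filterlim_at_top_mono, intro always_eventually allI)
    fix n
    have le: "total_retreat \<gamma> (f ^^ n) \<le> real n * l + C" using l(2)[of n] by linarith
    have eq: "- C / 2 - K + - l / 2 * real n = - (real n * l + C) / 2 - K" by (simp add: field_simps)
    have "0 \<le> dist (?x n) (\<gamma> 0)" by simp
    moreover have "(dist (?x n) (\<gamma> 0) - total_retreat \<gamma> (f ^^ n)) / 2 - K \<le> ray_product \<gamma> (?x n)"
      using ray_product_image_julia[OF ray nonexpanding_funpow[OF f(1)] coarsely_fixes_ray_funpow[OF f], of n "\<gamma> 0"]
      by simp
    ultimately show "- C / 2 - K + - l / 2 * real n \<le> ray_product \<gamma> (?x n)"
      unfolding eq using le by argo
  qed
  then show dw: "denjoy_wolff_point f (vertex \<gamma>)" by (rule denjoy_wolff_pointI[OF ray f(1)])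
  have "\<not> elliptic_map f"
  proof
    assume "elliptic_map f"
    then obtain B where B: "\<And>n. dist (?x n) (\<gamma> 0) \<le> B" using orbit_bounded_iff[OF f(1)] by blast
    have "\<forall>\<^sub>F n in sequentially. B + 1 \<le> ray_product \<gamma> (?x n)" using lim by (simp add: filterlim_at_top)
    then obtain n where "B + 1 \<le> ray_product \<gamma> (?x n)" by (auto simp: eventually_sequentially)
    then show False using B[of n] ray_product_le_dist[of \<gamma> "?x n"] by simp
  qed
  with dw show "hyperbolic_map f" using less l(1) unfolding hyperbolic_map_def by auto
qed

text \<open>The retreats are now only bounded above; the growth comes from the distance term,
  because the orbit escapes.\<close>

lemma stable_dilation_le_one:
  fixes \<gamma> :: "real \<Rightarrow> 'a"
  assumes ray: "geodesic_ray \<gamma>" and f: "nonexpanding f" "coarsely_fixes_ray f \<gamma>"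
    and ne: "\<not> elliptic_map f" and le: "stable_dilation f p (vertex \<gamma>) \<le> 1"
  shows "denjoy_wolff_point f (vertex \<gamma>)"
proof -
  obtain l C where l: "\<And>q. stable_dilation f q (vertex \<gamma>) = exp l"
    "\<And>n. \<bar>total_retreat \<gamma> (f ^^ n) - real n * l\<bar> \<le> C"
    by (rule stable_dilation_eq[OF ray f]) blast
  have l0: "l \<le> 0" using le l(1) by simp
  let ?x = "\<lambda>n. (f ^^ n) (\<gamma> 0)"
  have "filterlim (\<lambda>n. dist (\<gamma> 0) (?x n) * (1 / 2)) at_top sequentially"
    by (rule filterlim_at_top_mult_tendsto_pos[OF tendsto_const _ nonelliptic_orbit_escapes[OF proper f(1) ne]]) simp
  from filterlim_tendsto_add_at_top[OF tendsto_const[of "- C / 2 - K"] this]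
  have "filterlim (\<lambda>n. ray_product \<gamma> (?x n)) at_top sequentially"
  proof (rule filterlim_at_top_mono, intro always_eventually allI)
    fix n
    have "real n * l \<le> 0" using l0 by (simp add: mult_nonneg_nonpos)
    then have "total_retreat \<gamma> (f ^^ n) \<le> C" using l(2)[of n] by linarith
    moreover have "(dist (\<gamma> 0) (?x n) - total_retreat \<gamma> (f ^^ n)) / 2 - K \<le> ray_product \<gamma> (?x n)"
      using ray_product_image_julia[OF ray nonexpanding_funpow[OF f(1)] coarsely_fixes_ray_funpow[OF f], of n "\<gamma> 0"]
      by (simp add: dist_commute)
    ultimately show "- C / 2 - K + dist (\<gamma> 0) (?x n) * (1 / 2) \<le> ray_product \<gamma> (?x n)"
      by argo
  qed
  then show ?thesis by (rule denjoy_wolff_pointI[OF ray f(1)])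
qed

lemma stable_dilation_le_oneI:
  fixes \<gamma> :: "real \<Rightarrow> 'a"
  assumes ray: "geodesic_ray \<gamma>" and f: "nonexpanding f" "coarsely_fixes_ray f \<gamma>"
    and D: "\<And>n t. 0 \<le> t \<Longrightarrow> retreat \<gamma> (f ^^ n) t \<le> D"
  shows "stable_dilation f p (vertex \<gamma>) \<le> 1"
proof -
  obtain l C where l: "\<And>q. stable_dilation f q (vertex \<gamma>) = exp l"
    "\<And>n. \<bar>total_retreat \<gamma> (f ^^ n) - real n * l\<bar> \<le> C"
    by (rule stable_dilation_eq[OF ray f]) blast
  have le: "real n * l \<le> C + D" for n
    using l(2)[of n] total_retreat_least[of \<gamma> "f ^^ n" D, OF D] by linarith
  have "l \<le> 0"
  proof (rule ccontr)
    assume "\<not> l \<le> 0"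
    then obtain n where "C + D < real n * l" using reals_Archimedean3[of l] by auto
    with le[of n] show False by simp
  qed
  then show ?thesis by (simp add: l(1))
qed

lemma elliptic_stable_dilation_one_iff:
  fixes \<gamma> :: "real \<Rightarrow> 'a"
  assumes ray: "geodesic_ray \<gamma>" and f: "nonexpanding f" "coarsely_fixes_ray f \<gamma>"
    and ell: "elliptic_map f"
  shows "stable_dilation f p (vertex \<gamma>) = 1 \<longleftrightarrow>
    Inr (vertex \<gamma>) \<in> gromov_compactification closure_of (Inl ` limit_retract f)"
  unfolding vertex_in_closure_iff[OF ray]
proof
  assume one: "stable_dilation f p (vertex \<gamma>) = 1"
  obtain l C where l: "\<And>q. stable_dilation f q (vertex \<gamma>) = exp l"
    "\<And>n. \<bar>total_retreat \<gamma> (f ^^ n) - real n * l\<bar> \<le> C"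
    by (rule stable_dilation_eq[OF ray f]) blast
  have "l = 0" using one l(1) by simp
  then have tr: "total_retreat \<gamma> (f ^^ n) \<le> C" for n using l(2)[of n] by simp
  show "\<forall>s. \<exists>y\<in>limit_retract f. s \<le> ray_product \<gamma> y"
  proof
    fix s
    \<comment> \<open>The images lose at most \<open>C + K\<close> in depth, the passage to a limit
      point at most 1.\<close>
    define t where "t = max 0 (s + C + K + 1)"
    have t: "0 \<le> t" "s + C + K + 1 \<le> t" by (auto simp: t_def)
    have ge: "s + 1 \<le> ray_product \<gamma> ((f ^^ n) (\<gamma> t))" for n
      using ray_product_image_ge_total[OF ray nonexpanding_funpow[OF f(1)] coarsely_fixes_ray_funpow[OF f] t(1), of n]
        tr[of n] t(2) by simp
    obtain B where "\<And>n. dist ((f ^^ id n) (\<gamma> t)) (\<gamma> t) \<le> B"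
      using ell orbit_bounded_iff[OF f(1)] by auto
    then obtain y r where y: "(\<lambda>k. (f ^^ id (r k)) (\<gamma> t)) \<longlonglongrightarrow> y" "y \<in> limit_retract f"
      by (rule cball_sequence_limit_retract[OF proper strict_mono_id])
    obtain k where "dist ((f ^^ r k) (\<gamma> t)) y < 1" using metric_LIMSEQ_D[OF y(1) zero_less_one] by auto
    then have "s \<le> ray_product \<gamma> y"
      using ge[of "r k"] ray_product_lipschitz[of \<gamma> "(f ^^ r k) (\<gamma> t)" y] by simp
    with y(2) show "\<exists>y\<in>limit_retract f. s \<le> ray_product \<gamma> y" by blast
  qed
next
  assume cl: "\<forall>s. \<exists>y\<in>limit_retract f. s \<le> ray_product \<gamma> y"
  let ?p = "\<gamma> 0"
  obtain B where B: "\<And>n. dist ((f ^^ n) ?p) ?p \<le> B" using ell orbit_bounded_iff[OF f(1)] by blast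
  \<comment> \<open>After \<open>n\<close> steps from \<open>y\<close>, some \<open>m\<close>
    further steps lead back near \<open>y\<close>, while \<open>f ^^ m\<close> moves
    \<open>?p\<close> by at most \<open>B\<close>. So \<open>f ^^ n\<close> cannot have brought
    \<open>y\<close> much closer to \<open>?p\<close>, whatever \<open>n\<close> is.\<close>
  have "retreat \<gamma> (f ^^ n) t \<le> (B + 1) + 2 * K" if t: "0 \<le> t" for n t
  proof (rule retreat_le_of_approach[OF ray nonexpanding_funpow[OF f(1)] _ t])
    fix s
    obtain y where y: "y \<in> limit_retract f" "s \<le> ray_product \<gamma> y" using cl by blast
    obtain m where m: "dist ((f ^^ (n + m)) y) y < 1"
      using limit_retract_recurrent[OF f(1) y(1) zero_less_one] by blast
    have "dist ((f ^^ (m + n)) y) ((f ^^ m) ?p) \<le> dist ((f ^^ n) y) ?p"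
      using nonexpandingD[OF nonexpanding_funpow[OF f(1)], of m "(f ^^ n) y" ?p] by (simp add: funpow_add)
    then have "dist y ?p - dist ((f ^^ n) y) ?p \<le> B + 1"
      using m B[of m] dist_triangle[of y ?p "(f ^^ (n + m)) y"]
        dist_triangle[of "(f ^^ (n + m)) y" ?p "(f ^^ m) ?p"] by (simp add: dist_commute add.commute)
    with y(2) show "\<exists>z. s \<le> ray_product \<gamma> z \<and> dist z ?p - dist ((f ^^ n) z) ?p \<le> B + 1" by blast
  qed
  then have "stable_dilation f p (vertex \<gamma>) \<le> 1" by (rule stable_dilation_le_oneI[OF ray f])
  \<comment> \<open>A smaller value would make \<open>f\<close> hyperbolic, hence non-elliptic by
    definition.\<close>
  moreover have "\<not> stable_dilation f p (vertex \<gamma>) < 1"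
    using stable_dilation_less_one(1)[OF ray f, of p] ell by (auto simp: hyperbolic_map_def)
  ultimately show "stable_dilation f p (vertex \<gamma>) = 1" by simp
qed

end

theorem proposition4p16:
  fixes f :: "'a::metric_space \<Rightarrow> 'a" and p :: 'a
  assumes "proper_space TYPE('a)"
    and "geodesic_space TYPE('a)"
    and "gromov_hyperbolic_space TYPE('a)"
    and "\<And>x y. dist (f x) (f y) \<le> dist x y"
  shows
    "(\<forall>\<eta>. boundary_regular_fixed_point f \<eta> \<and> stable_dilation f p \<eta> < 1 \<longrightarrow>
        hyperbolic_map f \<and> denjoy_wolff_point f \<eta>) \<and>
     (\<not> elliptic_map f \<longrightarrow>
        (\<exists>\<zeta>. denjoy_wolff_point f \<zeta> \<and>
          (\<forall>\<eta>. boundary_regular_fixed_point f \<eta> \<and> stable_dilation f p \<eta> \<le> 1 \<longleftrightarrow> \<eta> = \<zeta>))) \<and>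
     (elliptic_map f \<longrightarrow>
        (\<forall>\<eta>. boundary_regular_fixed_point f \<eta> \<longrightarrow>
          (stable_dilation f p \<eta> = 1 \<longleftrightarrow>
             Inr \<eta> \<in> gromov_compactification closure_of (Inl ` limit_retract f))))"
proof -
  obtain K where K: "\<forall>p x y z :: 'a.
      min (gromov_product p x y) (gromov_product p y z) - K \<le> gromov_product p x z"
    using four_point_inequality[OF assms(2,3)] by (rule exE)
  interpret proper_hyperbolic "TYPE('a)" K
    using assms(1,2) K by unfold_locales simp_all
  have f: "nonexpanding f" using assms(4) by (simp add: nonexpanding_def)
  \<comment> \<open>All representing rays start at \<open>p\<close>, like the one from
    \<open>escaping_orbit_converges\<close>, since \<open>tends_to_boundary_unique\<close> compares
    rays with a common origin.\<close>
  have ray: "\<exists>\<gamma>. geodesic_ray \<gamma> \<and> \<gamma> 0 = p \<and> \<eta> = vertex \<gamma> \<and> coarsely_fixes_ray f \<gamma>"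
    if brfp: "boundary_regular_fixed_point f \<eta>" for \<eta>
  proof -
    have "\<eta> \<in> gromov_boundary" using brfp by (simp add: boundary_regular_fixed_point_def)
    then obtain \<gamma> where "geodesic_ray \<gamma>" "\<eta> = vertex \<gamma>" "\<gamma> 0 = p" by (rule boundary_ray_from_point)
    with brfp show ?thesis using boundary_regular_fixed_point_iff[OF _ f] by blast
  qed
  show ?thesis
  proof (intro conjI impI allI)
    fix \<eta> assume \<eta>: "boundary_regular_fixed_point f \<eta> \<and> stable_dilation f p \<eta> < 1"
    then obtain \<gamma> where \<gamma>: "geodesic_ray \<gamma>" "\<eta> = vertex \<gamma>" "coarsely_fixes_ray f \<gamma>" using ray by blast
    show "hyperbolic_map f" "denjoy_wolff_point f \<eta>"
      using stable_dilation_less_one[OF \<gamma>(1) f \<gamma>(3)] \<eta> \<gamma>(2) by auto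
  next
    assume ne: "\<not> elliptic_map f"
    obtain \<gamma> where \<gamma>: "geodesic_ray \<gamma>" "\<gamma> 0 = p" "denjoy_wolff_point f (vertex \<gamma>)"
      "\<And>m t. 0 \<le> t \<Longrightarrow> retreat \<gamma> (f ^^ m) t \<le> 2 * K" "coarsely_fixes_ray f \<gamma>"
      using escaping_orbit_converges[OF f nonelliptic_orbit_escapes[OF assms(1) f ne]] by blast
    have "boundary_regular_fixed_point f (vertex \<gamma>)" "stable_dilation f p (vertex \<gamma>) \<le> 1"
      using boundary_regular_fixed_point_iff[OF \<gamma>(1) f] \<gamma>(5)
        stable_dilation_le_oneI[OF \<gamma>(1) f \<gamma>(5,4)] by auto
    moreover have "\<eta> = vertex \<gamma>"
      if \<eta>: "boundary_regular_fixed_point f \<eta>" "stable_dilation f p \<eta> \<le> 1" for \<eta>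
    proof -
      obtain \<sigma> where \<sigma>: "geodesic_ray \<sigma>" "\<sigma> 0 = p" "\<eta> = vertex \<sigma>" "coarsely_fixes_ray f \<sigma>"
        using ray[OF \<eta>(1)] by blast
      have "denjoy_wolff_point f (vertex \<sigma>)"
        using stable_dilation_le_one[OF \<sigma>(1) f \<sigma>(4) ne] \<eta>(2) \<sigma>(3) by simp
      then show ?thesis
        using tends_to_boundary_unique[OF \<sigma>(1) \<gamma>(1), of "\<lambda>n. (f ^^ n) p"] \<gamma>(2,3) \<sigma>(2,3)
        unfolding denjoy_wolff_point_def by simp
    qed
    ultimately show "\<exists>\<zeta>. denjoy_wolff_point f \<zeta> \<and>
        (\<forall>\<eta>. boundary_regular_fixed_point f \<eta> \<and> stable_dilation f p \<eta> \<le> 1 \<longleftrightarrow> \<eta> = \<zeta>)"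
      using \<gamma>(3) by blast
  next
    fix \<eta> assume ell: "elliptic_map f" and \<eta>: "boundary_regular_fixed_point f \<eta>"
    obtain \<gamma> where \<gamma>: "geodesic_ray \<gamma>" "\<eta> = vertex \<gamma>" "coarsely_fixes_ray f \<gamma>" using ray[OF \<eta>] by blast
    show "stable_dilation f p \<eta> = 1 \<longleftrightarrow>
        Inr \<eta> \<in> gromov_compactification closure_of (Inl ` limit_retract f)"
      unfolding \<gamma>(2) by (rule elliptic_stable_dilation_one_iff[OF \<gamma>(1) f \<gamma>(3) ell])
  qed
qed

end
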